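(* Let $X$ be a path-connected space, $x_0\in X$, and $H\leq\pi_1(X,x_0)$ a subgroup. If the endpoint projection $p_H:\widetilde{X}_H\to X$ has the unique path-lifting property, then $X$ has well-defined transfinite $\Pi_1$-products relative to $H$. The converse holds if $X$ is metrizable and $H$ is a normal subgroup of $\pi_1(X,x_0)$.
   Context: Paths are continuous maps from $[0,1]$; $\alpha^{-}$ is the reverse path, $\cdot$ is concatenation, $[\alpha]$ is the path-homotopy class, and a restriction $\alpha|_{[a,b]}$ is regarded as a path via the increasing linear homeomorphism $[0,1]\to[a,b]$ (if $a=b$ it is a constant path). Let $P(X,x_0)$ be the set of paths in $X$ starting at $x_0$. Define $\widetilde{X}_H=P(X,x_0)/\!\sim$ where $\alpha\sim\beta$ if and only if $\alpha(1)=\beta(1)$ and $[\alpha\cdot\beta^{-}]\in H$; the class of $\alpha$ is denoted $H[\alpha]$. $\widetilde{X}_H$ has the topology generated by the sets $B(H[\alpha],U)=\{H[\alpha\cdot\epsilon]\mid \epsilon \text{ a path starting at }\alpha(1)\text{ with }\epsilon([0,1])\subseteq U\}$, where $U$ is an open neighborhood of $\alpha(1)$ in $X$. The endpoint projection is $p_H(H[\alpha])=\alpha(1)$. A map $p:\widehat{X}\to X$ has the unique path-lifting property if whenever $\alpha,\beta:[0,1]\to\widehat{X}$ are paths with $\alpha(0)=\beta(0)$ and $p\circ\alpha=p\circ\beta$, then $\alpha=\beta$. $X$ has well-defined transfinite $\Pi_1$-products relative to $H$ if for every closed set $A\subseteq[0,1]$ containing $\{0,1\}$ and all paths $\alpha,\beta:([0,1],0)\to(X,x_0)$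 such that $\alpha|_A=\beta|_A$ and $[\alpha|_{[0,b]}\cdot\beta|_{[a,b]}^{-}\cdot\alpha|_{[0,a]}^{-}]\in H$ for every component $(a,b)$ of $[0,1]\setminus A$, we have $[\alpha\cdot\beta^{-}]\in H$. *)

theory Defs
  imports "HOL-Analysis.Analysis" "HOL-Algebra.Coset"
begin

text \<open>
  A space is a subset X of a type of class \<open>topological_space\<close>, with the subspace topology.
  Paths are functions on all of \<open>real\<close> of which only the values on \<open>{0..1}\<close> matter;
  \<open>homotopic_paths X\<close> (homotopy in X rel endpoints) identifies functions that agree
  on \<open>{0..1}\<close>, so the values elsewhere do not affect homotopy classes.
\<close>

definition paths_from :: "'a::topological_space set \<Rightarrow> 'a \<Rightarrow> (real \<Rightarrow> 'a) set" where
  "paths_from X x = {\<alpha>. path \<alpha> \<and> path_image \<alpha> \<subseteq> X \<and> pathstart \<alpha> = x}"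

text \<open>The library's \<open>subpath\<close> and \<open>linepath\<close> are restricted to normed vector spaces.\<close>

definition restrict_path :: "real \<Rightarrow> real \<Rightarrow> (real \<Rightarrow> 'a) \<Rightarrow> real \<Rightarrow> 'a" where
  "restrict_path a b \<alpha> = (\<lambda>t. \<alpha> (a + (b - a) * t))"

definition path_class :: "'a::topological_space set \<Rightarrow> (real \<Rightarrow> 'a) \<Rightarrow> (real \<Rightarrow> 'a) set" where
  "path_class X \<alpha> = {\<beta>. homotopic_paths X \<alpha> \<beta>}"

definition loops_at :: "'a::topological_space set \<Rightarrow> 'a \<Rightarrow> (real \<Rightarrow> 'a) set" where
  "loops_at X x = {\<gamma> \<in> paths_from X x. pathfinish \<gamma> = x}"

definition fundamental_group ::
    "'a::topological_space set \<Rightarrow> 'a \<Rightarrow> (real \<Rightarrow> 'a) set monoid" where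
  "fundamental_group X x =
     \<lparr>carrier = path_class X ` loops_at X x,
      mult = (\<lambda>A B. \<Union>\<alpha>\<in>A. \<Union>\<beta>\<in>B. path_class X (\<alpha> +++ \<beta>)),
      one = path_class X (\<lambda>_. x)\<rparr>"

definition H_related ::
    "'a::topological_space set \<Rightarrow> 'a \<Rightarrow> (real \<Rightarrow> 'a) set set \<Rightarrow> ((real \<Rightarrow> 'a) \<times> (real \<Rightarrow> 'a)) set" where
  "H_related X x0 H =
     {(\<alpha>, \<beta>). \<alpha> \<in> paths_from X x0 \<and> \<beta> \<in> paths_from X x0 \<and> pathfinish \<alpha> = pathfinish \<beta> \<and>
        path_class X (\<alpha> +++ reversepath \<beta>) \<in> H}"

definition H_class ::
    "'a::topological_space set \<Rightarrow> 'a \<Rightarrow> (real \<Rightarrow> 'a) set set \<Rightarrow> (real \<Rightarrow> 'a) \<Rightarrow> (real \<Rightarrow> 'a) set" where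
  "H_class X x0 H \<alpha> = H_related X x0 H `` {\<alpha>}"

definition basic_nbhd ::
    "'a::topological_space set \<Rightarrow> 'a \<Rightarrow> (real \<Rightarrow> 'a) set set \<Rightarrow> (real \<Rightarrow> 'a) \<Rightarrow> 'a set
      \<Rightarrow> (real \<Rightarrow> 'a) set set" where
  "basic_nbhd X x0 H \<alpha> U =
     {H_class X x0 H (\<alpha> +++ \<epsilon>) | \<epsilon>. \<epsilon> \<in> paths_from X (pathfinish \<alpha>) \<and> path_image \<epsilon> \<subseteq> U}"

text \<open>
  The space of H-classes of paths. Its underlying set is \<open>paths_from X x0 // H_related X x0 H\<close>;
  see lemma \<open>topspace_path_cover\<close> below.
\<close>

definition path_cover ::
    "'a::topological_space set \<Rightarrow> 'a \<Rightarrow> (real \<Rightarrow> 'a) set set \<Rightarrow> (real \<Rightarrow> 'a) set topology" where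
  "path_cover X x0 H =
     topology_generated_by
       {basic_nbhd X x0 H \<alpha> U | \<alpha> U.
          \<alpha> \<in> paths_from X x0 \<and> openin (top_of_set X) U \<and> pathfinish \<alpha> \<in> U}"

text \<open>The common endpoint of the paths in a class.\<close>

definition endpoint_proj :: "(real \<Rightarrow> 'a::topological_space) set \<Rightarrow> 'a" where
  "endpoint_proj c = the_elem (pathfinish ` c)"

definition unique_path_lifting :: "'b topology \<Rightarrow> ('b \<Rightarrow> 'a) \<Rightarrow> bool" where
  "unique_path_lifting E p \<longleftrightarrow>
     (\<forall>\<alpha> \<beta>. pathin E \<alpha> \<and> pathin E \<beta> \<and> \<alpha> 0 = \<beta> 0 \<and> (\<forall>t\<in>{0..1}. p (\<alpha> t) = p (\<beta> t))
        \<longrightarrow> (\<forall>t\<in>{0..1}. \<alpha> t = \<beta> t))"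

definition well_defined_transfinite_products ::
    "'a::topological_space set \<Rightarrow> 'a \<Rightarrow> (real \<Rightarrow> 'a) set set \<Rightarrow> bool" where
  "well_defined_transfinite_products X x0 H \<longleftrightarrow>
     (\<forall>A \<alpha> \<beta>. closed A \<and> A \<subseteq> {0..1} \<and> {0, 1} \<subseteq> A \<and>
        \<alpha> \<in> paths_from X x0 \<and> \<beta> \<in> paths_from X x0 \<and> (\<forall>t\<in>A. \<alpha> t = \<beta> t) \<and>
        (\<forall>a b. {a<..<b} \<in> components ({0..1} - A) \<longrightarrow>
           path_class X
             (restrict_path 0 b \<alpha> +++ reversepath (restrict_path a b \<beta>)
               +++ reversepath (restrict_path 0 a \<alpha>)) \<in> H)
        \<longrightarrow> path_class X (\<alpha> +++ reversepath \<beta>) \<in> H)"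


subsection \<open>The fundamental group is a group\<close>

lemma path_class_eq:
  "homotopic_paths X \<alpha> \<beta> \<Longrightarrow> path_class X \<alpha> = path_class X \<beta>"
  unfolding path_class_def by (blast intro: homotopic_paths_sym homotopic_paths_trans)

lemma path_class_self: "\<alpha> \<in> paths_from X x \<Longrightarrow> \<alpha> \<in> path_class X \<alpha>"
  by (simp add: path_class_def paths_from_def)

lemma loops_at_iff:
  "\<gamma> \<in> loops_at X x \<longleftrightarrow>
     path \<gamma> \<and> path_image \<gamma> \<subseteq> X \<and> pathstart \<gamma> = x \<and> pathfinish \<gamma> = x"
  by (auto simp: loops_at_def paths_from_def)

lemma path_class_mult:
  assumes "path \<alpha>" "path_image \<alpha> \<subseteq> X" "path \<beta>" "path_image \<beta> \<subseteq> X" "pathfinish \<alpha> = pathstart \<beta>"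
  shows "(\<Union>\<alpha>'\<in>path_class X \<alpha>. \<Union>\<beta>'\<in>path_class X \<beta>. path_class X (\<alpha>' +++ \<beta>'))
           = path_class X (\<alpha> +++ \<beta>)"
proof -
  have "path_class X (\<alpha>' +++ \<beta>') = path_class X (\<alpha> +++ \<beta>)"
    if "\<alpha>' \<in> path_class X \<alpha>" "\<beta>' \<in> path_class X \<beta>" for \<alpha>' \<beta>'
    using that assms(5) unfolding path_class_def [of _ \<alpha>] path_class_def [of _ \<beta>] mem_Collect_eq
    by (metis path_class_eq homotopic_paths_join)
  moreover have "\<alpha> \<in> path_class X \<alpha>" "\<beta> \<in> path_class X \<beta>"
    using assms by (auto simp: path_class_def)
  ultimately show ?thesis
    by blast
qed

lemma homotopic_paths_via_real:
  fixes \<gamma> :: "real \<Rightarrow> 'a::topological_space"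
  assumes "path \<gamma>" "path_image \<gamma> \<subseteq> X" "homotopic_paths {0..1} f g"
  shows "homotopic_paths X (\<gamma> \<circ> f) (\<gamma> \<circ> g)"
  using homotopic_paths_continuous_image [OF assms(3), of \<gamma> X] assms(1,2)
  by (auto simp: path_def path_image_def)

lemma const_join_homotopic:
  fixes \<gamma> :: "real \<Rightarrow> 'a::topological_space"
  assumes "path \<gamma>" "path_image \<gamma> \<subseteq> X" "pathstart \<gamma> = x"
  shows "homotopic_paths X ((\<lambda>_. x) +++ \<gamma>) \<gamma>"
proof -
  have "homotopic_paths {0..1} (linepath 0 0 +++ linepath 0 1) (linepath 0 (1::real))"
    by (rule homotopic_paths_lid') (auto simp: closed_segment_eq_real_ivl)
  from homotopic_paths_via_real [OF assms(1,2) this]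
  have "homotopic_paths X (\<gamma> \<circ> (linepath 0 0 +++ linepath 0 1)) (\<gamma> \<circ> linepath 0 1)" .
  moreover have "\<gamma> \<circ> (linepath 0 0 +++ linepath 0 1) = (\<lambda>_. x) +++ \<gamma>" "\<gamma> \<circ> linepath 0 1 = \<gamma>"
    using assms(3) by (auto simp: fun_eq_iff joinpaths_def linepath_def pathstart_def)
  ultimately show ?thesis by simp
qed

lemma reversepath_join_homotopic:
  fixes \<gamma> :: "real \<Rightarrow> 'a::topological_space"
  assumes "path \<gamma>" "path_image \<gamma> \<subseteq> X" "pathfinish \<gamma> = x"
  shows "homotopic_paths X (reversepath \<gamma> +++ \<gamma>) (\<lambda>_. x)"
proof -
  have "homotopic_paths {0..1} (reversepath (linepath 0 1) +++ linepath 0 1)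
          (linepath (pathfinish (linepath 0 1)) (pathfinish (linepath 0 (1::real))))"
    by (rule homotopic_paths_linv) (auto simp: closed_segment_eq_real_ivl)
  from homotopic_paths_via_real [OF assms(1,2) this]
  have "homotopic_paths X (\<gamma> \<circ> (reversepath (linepath 0 1) +++ linepath 0 1)) (\<gamma> \<circ> linepath 1 1)"
    by simp
  moreover have "\<gamma> \<circ> (reversepath (linepath 0 1) +++ linepath 0 1) = reversepath \<gamma> +++ \<gamma>"
      "\<gamma> \<circ> linepath 1 1 = (\<lambda>_. x)"
    using assms(3)
    by (auto simp: fun_eq_iff joinpaths_def linepath_def reversepath_def pathfinish_def)
  ultimately show ?thesis by simp
qed

lemma fundamental_group_mult:
  assumes "\<alpha> \<in> loops_at X x" "\<beta> \<in> loops_at X x"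
  shows "path_class X \<alpha> \<otimes>\<^bsub>fundamental_group X x\<^esub> path_class X \<beta> = path_class X (\<alpha> +++ \<beta>)"
  using path_class_mult [of \<alpha> X \<beta>] assms by (simp add: fundamental_group_def loops_at_iff)

lemma loops_at_join: "\<alpha> \<in> loops_at X x \<Longrightarrow> \<beta> \<in> loops_at X x \<Longrightarrow> \<alpha> +++ \<beta> \<in> loops_at X x"
  by (simp add: loops_at_iff subset_path_image_join)

lemma loops_at_reverse: "\<alpha> \<in> loops_at X x \<Longrightarrow> reversepath \<alpha> \<in> loops_at X x"
  by (simp add: loops_at_iff)

lemma loops_at_const: "x \<in> X \<Longrightarrow> (\<lambda>_. x) \<in> loops_at X x"
  by (auto simp: loops_at_iff path_def path_image_def pathstart_def pathfinish_def)

lemma group_fundamental_group: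
  assumes "x \<in> X"
  shows "group (fundamental_group X x)"
proof (rule groupI)
  let ?G = "fundamental_group X x"
  have C: "carrier ?G = path_class X ` loops_at X x" and I: "\<one>\<^bsub>?G\<^esub> = path_class X (\<lambda>_. x)"
    by (auto simp: fundamental_group_def)
  show "a \<otimes>\<^bsub>?G\<^esub> b \<in> carrier ?G" if "a \<in> carrier ?G" "b \<in> carrier ?G" for a b
    using that by (auto simp: C fundamental_group_mult loops_at_join)
  show "\<one>\<^bsub>?G\<^esub> \<in> carrier ?G"
    using assms by (auto simp: C I loops_at_const)
  show "a \<otimes>\<^bsub>?G\<^esub> b \<otimes>\<^bsub>?G\<^esub> c = a \<otimes>\<^bsub>?G\<^esub> (b \<otimes>\<^bsub>?G\<^esub> c)"
    if abc: "a \<in> carrier ?G" "b \<in> carrier ?G" "c \<in> carrier ?G" for a b c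
  proof -
    obtain p q r where "p \<in> loops_at X x" "q \<in> loops_at X x" "r \<in> loops_at X x"
      and "a = path_class X p" "b = path_class X q" "c = path_class X r"
      using abc by (auto simp: C)
    moreover from this have "homotopic_paths X (p +++ (q +++ r)) ((p +++ q) +++ r)"
      by (intro homotopic_paths_assoc) (auto simp: loops_at_iff)
    ultimately show ?thesis
      by (simp add: fundamental_group_mult loops_at_join path_class_eq)
  qed
  show "\<one>\<^bsub>?G\<^esub> \<otimes>\<^bsub>?G\<^esub> a = a" if a: "a \<in> carrier ?G" for a
  proof -
    obtain p where p: "p \<in> loops_at X x" "a = path_class X p"
      using a by (auto simp: C)
    then have "homotopic_paths X ((\<lambda>_. x) +++ p) p"
      by (intro const_join_homotopic) (auto simp: loops_at_iff)
    with p assms show ?thesis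
      by (simp add: I fundamental_group_mult loops_at_const path_class_eq)
  qed
  show "\<exists>b\<in>carrier ?G. b \<otimes>\<^bsub>?G\<^esub> a = \<one>\<^bsub>?G\<^esub>" if a: "a \<in> carrier ?G" for a
  proof -
    obtain p where p: "p \<in> loops_at X x" "a = path_class X p"
      using a by (auto simp: C)
    then have "homotopic_paths X (reversepath p +++ p) (\<lambda>_. x)"
      by (intro reversepath_join_homotopic) (auto simp: loops_at_iff)
    with p have "path_class X (reversepath p) \<otimes>\<^bsub>?G\<^esub> a = \<one>\<^bsub>?G\<^esub>"
      by (simp add: I fundamental_group_mult loops_at_reverse path_class_eq)
    with p show ?thesis
      by (auto simp: C loops_at_reverse)
  qed
qed


subsection \<open>The underlying set of the space of H-classes, and the endpoint projection\<close>

lemma right_const_homotopic: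
  fixes \<gamma> :: "real \<Rightarrow> 'a::topological_space"
  assumes "path \<gamma>" "path_image \<gamma> \<subseteq> X" "pathfinish \<gamma> = x"
  shows "homotopic_paths X (\<gamma> +++ (\<lambda>_. x)) \<gamma>"
proof -
  have "homotopic_paths X ((\<lambda>_. x) +++ reversepath \<gamma>) (reversepath \<gamma>)"
    using assms by (intro const_join_homotopic) auto
  from homotopic_paths_reversepath_D [OF this]
  have "homotopic_paths X (reversepath ((\<lambda>_. x) +++ reversepath \<gamma>)) \<gamma>"
    by simp
  moreover have "reversepath ((\<lambda>_. x) +++ reversepath \<gamma>) = reversepath (reversepath \<gamma>) +++ reversepath (\<lambda>_. x)"
    using assms by (intro reversepath_joinpaths) (auto simp: pathfinish_def pathstart_def reversepath_def)
  moreover have "reversepath (\<lambda>_. x) = (\<lambda>_. x)"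
    by (simp add: reversepath_def)
  ultimately show ?thesis by simp
qed

lemma H_class_cong:
  assumes "homotopic_paths X \<alpha> \<alpha>'"
  shows "H_class X x0 H \<alpha> = H_class X x0 H \<alpha>'"
proof -
  have *: "homotopic_paths X (\<alpha> +++ reversepath \<beta>) (\<alpha>' +++ reversepath \<beta>)"
    if "\<beta> \<in> paths_from X x0" "pathfinish \<alpha> = pathfinish \<beta>" for \<beta>
    using that assms by (intro homotopic_paths_join) (auto simp: paths_from_def)
  have "\<alpha> \<in> paths_from X x0 \<longleftrightarrow> \<alpha>' \<in> paths_from X x0" "pathfinish \<alpha> = pathfinish \<alpha>'"
    using homotopic_paths_imp_path [OF assms] homotopic_paths_imp_subset [OF assms]
      homotopic_paths_imp_pathstart [OF assms] homotopic_paths_imp_pathfinish [OF assms]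
    by (auto simp: paths_from_def)
  moreover have "path_class X (\<alpha> +++ reversepath \<beta>) = path_class X (\<alpha>' +++ reversepath \<beta>)"
    if "\<beta> \<in> paths_from X x0" "pathfinish \<alpha> = pathfinish \<beta>" for \<beta>
    using * [OF that] by (rule path_class_eq)
  ultimately show ?thesis
    by (auto simp: H_class_def H_related_def)
qed

lemma topspace_path_cover:
  "topspace (path_cover X x0 H) = paths_from X x0 // H_related X x0 H"
proof -
  have in_quot: "H_class X x0 H (\<alpha> +++ \<epsilon>) \<in> paths_from X x0 // H_related X x0 H"
    if "\<alpha> \<in> paths_from X x0" "\<epsilon> \<in> paths_from X (pathfinish \<alpha>)" for \<alpha> \<epsilon>
    using that unfolding H_class_def
    by (intro quotientI) (auto simp: paths_from_def path_image_join)
  have "H_class X x0 H \<alpha> \<in> basic_nbhd X x0 H \<alpha> X \<and> pathfinish \<alpha> \<in> X"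
    if "\<alpha> \<in> paths_from X x0" for \<alpha>
  proof
    show fin: "pathfinish \<alpha> \<in> X"
      using that pathfinish_in_path_image by (auto simp: paths_from_def)
    have "homotopic_paths X (\<alpha> +++ (\<lambda>_. pathfinish \<alpha>)) \<alpha>"
      using that by (intro right_const_homotopic) (auto simp: paths_from_def)
    then have "H_class X x0 H \<alpha> = H_class X x0 H (\<alpha> +++ (\<lambda>_. pathfinish \<alpha>))"
      by (metis H_class_cong)
    then show "H_class X x0 H \<alpha> \<in> basic_nbhd X x0 H \<alpha> X"
      using loops_at_const [OF fin] unfolding basic_nbhd_def loops_at_def
      by (auto simp: paths_from_def)
  qed
  note rep = this
  show ?thesis
  proof
    show "topspace (path_cover X x0 H) \<subseteq> paths_from X x0 // H_related X x0 H"
      using in_quot by (auto simp: path_cover_def basic_nbhd_def)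
    show "paths_from X x0 // H_related X x0 H \<subseteq> topspace (path_cover X x0 H)"
    proof
      fix c assume "c \<in> paths_from X x0 // H_related X x0 H"
      then obtain \<alpha> where "\<alpha> \<in> paths_from X x0" "c = H_class X x0 H \<alpha>"
        unfolding H_class_def by (auto elim: quotientE)
      with rep [of \<alpha>] show "c \<in> topspace (path_cover X x0 H)"
        unfolding path_cover_def topology_generated_by_topspace
        using \<open>\<alpha> \<in> paths_from X x0\<close> \<open>c = H_class X x0 H \<alpha>\<close> openin_subtopology_self
        by (intro UnionI [of "basic_nbhd X x0 H \<alpha> X"] CollectI exI [of _ \<alpha>] exI [of _ X]) auto
    qed
  qed
qed

lemma endpoint_proj_H_class:
  assumes "x0 \<in> X" "subgroup H (fundamental_group X x0)" "\<alpha> \<in> paths_from X x0"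
  shows "endpoint_proj (H_class X x0 H \<alpha>) = pathfinish \<alpha>"
proof -
  have "homotopic_paths X (\<alpha> +++ reversepath \<alpha>) (\<lambda>_. x0)"
    using reversepath_join_homotopic [of "reversepath \<alpha>" X x0] assms(3)
    by (simp add: paths_from_def)
  then have "path_class X (\<alpha> +++ reversepath \<alpha>) \<in> H"
    using subgroup.one_closed [OF assms(2)] by (simp add: fundamental_group_def path_class_eq)
  then have self: "\<alpha> \<in> H_class X x0 H \<alpha>"
    using assms(3) by (simp add: H_class_def H_related_def)
  have fin: "pathfinish \<beta> = pathfinish \<alpha>" if "\<beta> \<in> H_class X x0 H \<alpha>" for \<beta>
    using that by (simp add: H_class_def H_related_def)
  have "pathfinish ` H_class X x0 H \<alpha> = {pathfinish \<alpha>}"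
  proof
    show "pathfinish ` H_class X x0 H \<alpha> \<subseteq> {pathfinish \<alpha>}"
      by (rule image_subsetI) (simp only: singleton_iff fin)
    show "{pathfinish \<alpha>} \<subseteq> pathfinish ` H_class X x0 H \<alpha>"
      using self by (intro subsetI) (simp add: image_eqI)
  qed
  then show ?thesis
    by (simp add: endpoint_proj_def)
qed

end

theory Submission
  imports Defs
begin

text \<open>
  If unique path lifting holds and \<open>\<alpha>\<close>, \<open>\<beta>\<close> agree on \<open>A\<close> and are H-equivalent across its gaps,
  then following \<open>\<alpha>\<close> up to the last point of \<open>A\<close> before \<open>t\<close> and \<open>\<beta>\<close> from there to \<open>t\<close> defines a
  second continuous lift of \<open>\<beta>\<close>; it must be the standard one, and at \<open>t = 1\<close> this says
  that \<open>\<alpha>\<close> and \<open>\<beta>\<close> are H-equivalent.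

  Conversely, let \<open>f\<close> be a lift of \<open>\<gamma>\<close>. For \<open>a < b\<close> the points \<open>f a\<close> and \<open>f b\<close> are joined by
  a path \<open>r a b\<close> in X, and metrizability allows these to be chosen uniformly small as \<open>b - a\<close> tends
  to 0. With \<open>m = (a + b) / 2\<close>, the loop \<open>T a b = r a m\<^sup>- \<cdot> r a b \<cdot> r m b\<^sup>-\<close> at \<open>\<gamma> m\<close> is
  H-trivial, and \<open>r a b\<close> is homotopic to \<open>r a m \<cdot> T a b \<cdot> r m b\<close> inside the union of the three
  small paths. Iterating this over all dyadic intervals gives a homotopy from \<open>r 0 1\<close> to a path
  that agrees with \<open>\<gamma>\<close> composed with a Cantor function on a Cantor set and runs through the loops
  \<open>T a b\<close> on the gaps. By normality these loops are H-trivial with respect to every base path, so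
  the transfinite product hypothesis identifies that path with \<open>\<gamma>\<close>, and \<open>f 1\<close> is the
  endpoint of the standard lift.
\<close>

subsection \<open>Paths as images of real intervals\<close>

text \<open>The obstacle in the converse is that X need not be semilocally simply connected: two
  short paths with the same ends may differ by an essential loop, so a chain of short paths
  representing increments of \<open>f\<close> cannot be compared with \<gamma> directly. The loops T
  a b collect exactly these differences. No finite stage removes the paths r; only in the limit do
  they shrink to points of \<gamma> and leave the loops alone. Confining each elementary homotopy to
  the three short paths involved makes the infinitely many homotopies converge. Normality enters
  because T a b is known to be H-trivial along a representative of f m, whereas the product
  hypothesis approaches the gap along the limit path. In the other direction the difficulty is
  continuity where gaps accumulate at a point of A. Passing from s to t uses the gap hypothesis only
  once: follow \<beta> to the next point of A, then \<alpha> across all intermediate gaps, then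
  \<beta> again.\<close>

lemma path_in_via_real:
  fixes p :: "real \<Rightarrow> 'a::topological_space"
  assumes "path p" "path_image p \<subseteq> X" "continuous_on {0..1} f" "f ` {0..1} \<subseteq> {0..1}"
  shows "path (p \<circ> f)" "path_image (p \<circ> f) \<subseteq> X"
proof -
  show "path (p \<circ> f)"
    using assms unfolding path_def by (metis continuous_on_compose continuous_on_subset)
  show "path_image (p \<circ> f) \<subseteq> X"
    using assms(2,4) unfolding path_image_def image_comp[symmetric] by blast
qed

lemma homotopic_paths_real_interval:
  fixes f g :: "real \<Rightarrow> real"
  assumes "continuous_on {0..1} f" "continuous_on {0..1} g"
    "f ` {0..1} \<subseteq> {0..1}" "g ` {0..1} \<subseteq> {0..1}" "f 0 = g 0" "f 1 = g 1"
  shows "homotopic_paths {0..1} f g"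
proof (rule homotopic_paths_linear)
  show "closed_segment (f t) (g t) \<subseteq> {0..1}" if "t \<in> {0..1}" for t
    using imageI[OF that, of f] imageI[OF that, of g] assms(3,4)
    by (intro closed_segment_subset convex_real_interval) blast+
qed (use assms in \<open>auto simp: path_def pathstart_def pathfinish_def\<close>)

text \<open>Reparametrisations with common ends are homotopic because [0,1] is convex; pushing
  forward along \<open>p\<close> carries this to an arbitrary space. Gluing of restrictions and the
  passage from \<gamma> composed with \<open>cantor_fun\<close> to \<gamma> both rest on it.\<close>

lemma homotopic_paths_compose_real:
  fixes p :: "real \<Rightarrow> 'a::topological_space"
  assumes "path p" "path_image p \<subseteq> X"
    "continuous_on {0..1} f" "continuous_on {0..1} g"
    "f ` {0..1} \<subseteq> {0..1}" "g ` {0..1} \<subseteq> {0..1}" "f 0 = g 0" "f 1 = g 1"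
  shows "homotopic_paths X (p \<circ> f) (p \<circ> g)"
  using homotopic_paths_via_real[OF assms(1,2) homotopic_paths_real_interval[OF assms(3-8)]] .

lemma path_const [simp]: "path (\<lambda>_. x)"
  by (simp add: path_def)

lemma pathstart_const [simp]: "pathstart (\<lambda>_. x) = x"
  by (simp add: pathstart_def)

lemma pathfinish_const [simp]: "pathfinish (\<lambda>_. x) = x"
  by (simp add: pathfinish_def)

lemma path_image_const [simp]: "path_image (\<lambda>_. x) = {x}"
  by (auto simp: path_image_def)

lemma reversepath_const [simp]: "reversepath (\<lambda>_. x) = (\<lambda>_. x)"
  by (simp add: reversepath_def)

lemma affine_unit_interval:
  fixes s t :: real
  assumes "s \<in> {0..1}" "t \<in> {0..1}" "u \<in> {0..1}"
  shows "s + (t - s) * u \<in> {min s t..max s t}"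
proof -
  have "s + (t - s) * u = (1 - u) * s + u * t" by (simp add: algebra_simps)
  moreover have "(1 - u) * s + u * t \<le> max s t"
    using assms by (intro convex_bound_le) auto
  moreover have "min s t \<le> (1 - u) * s + u * t"
  proof -
    have "(1 - u) * min s t + u * min s t \<le> (1 - u) * s + u * t"
      using assms by (intro add_mono mult_left_mono) auto
    then show ?thesis by (simp add: algebra_simps)
  qed
  ultimately show ?thesis by auto
qed

lemma affine_image_unit_interval:
  fixes s t :: real
  assumes "s \<in> {0..1}" "t \<in> {0..1}"
  shows "(\<lambda>u. s + (t - s) * u) ` {0..1} \<subseteq> {min s t..max s t}"
  using affine_unit_interval[OF assms] by blast

lemma min_max_interval_subset:
  fixes s t :: real
  assumes "s \<in> {0..1}" "t \<in> {0..1}"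
  shows "{min s t..max s t} \<subseteq> {0..1}"
  using assms by auto

lemma affine_image_subset_unit:
  fixes s t :: real
  assumes "s \<in> {0..1}" "t \<in> {0..1}"
  shows "(\<lambda>u. s + (t - s) * u) ` {0..1} \<subseteq> {0..1}"
  using affine_image_unit_interval[OF assms] min_max_interval_subset[OF assms] by (rule subset_trans)

lemma restrict_path_compose: "restrict_path s t p = p \<circ> (\<lambda>u. s + (t - s) * u)"
  by (auto simp: restrict_path_def)

lemma pathstart_restrict_path [simp]: "pathstart (restrict_path s t p) = p s"
  by (simp add: restrict_path_def pathstart_def)

lemma pathfinish_restrict_path [simp]: "pathfinish (restrict_path s t p) = p t"
  by (simp add: restrict_path_def pathfinish_def)

lemma reversepath_restrict_path [simp]: "reversepath (restrict_path s t p) = restrict_path t s p"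
  by (auto simp: restrict_path_def reversepath_def fun_eq_iff algebra_simps)

lemma restrict_path_refl: "restrict_path s s p = (\<lambda>_. p s)"
  by (auto simp: restrict_path_def)

lemma restrict_path_0_1 [simp]: "restrict_path 0 1 p = p"
  by (auto simp: restrict_path_def)

lemma path_image_restrict_path:
  assumes "s \<in> {0..1}" "t \<in> {0..1}"
  shows "path_image (restrict_path s t p) \<subseteq> p ` {min s t..max s t}"
  using affine_unit_interval[OF assms] by (auto simp: path_image_def restrict_path_def)

lemma path_image_restrict_path_subset:
  assumes "s \<in> {0..1}" "t \<in> {0..1}" "path_image p \<subseteq> X"
  shows "path_image (restrict_path s t p) \<subseteq> X"
  using path_image_restrict_path[OF assms(1,2), of p] min_max_interval_subset[OF assms(1,2)]
    assms(3) unfolding path_image_def by blast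

lemma path_restrict_path:
  assumes "s \<in> {0..1}" "t \<in> {0..1}" "path p"
  shows "path (restrict_path s t p)"
  unfolding restrict_path_compose
  using affine_image_subset_unit[OF assms(1,2)] assms(3)
  by (intro path_in_via_real(1)[where X=UNIV] continuous_intros) simp_all

lemma restrict_path_join_homotopic:
  fixes p :: "real \<Rightarrow> 'a::topological_space"
  assumes "path p" "path_image p \<subseteq> X" "r \<in> {0..1}" "s \<in> {0..1}" "t \<in> {0..1}"
  shows "homotopic_paths X (restrict_path r s p +++ restrict_path s t p) (restrict_path r t p)"
proof -
  let ?f = "(\<lambda>u. r + (s - r) * u) +++ (\<lambda>u. s + (t - s) * u)"
  let ?g = "\<lambda>u. r + (t - r) * u"
  have im: "path_image ?f \<subseteq> {0..1}"
    unfolding path_image_def[symmetric]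
    by (intro subset_path_image_join)
      (use affine_image_subset_unit assms(3-5) in \<open>simp_all only: path_image_def\<close>)
  have pa: "path ?f"
    by (intro path_join_imp) (auto simp: path_def pathfinish_def pathstart_def intro!: continuous_intros)
  have "homotopic_paths X (p \<circ> ?f) (p \<circ> ?g)"
  proof (rule homotopic_paths_compose_real[OF assms(1,2)])
    show "continuous_on {0..1} ?f" using pa by (simp add: path_def)
    show "?f ` {0..1} \<subseteq> {0..1}" using im by (simp add: path_image_def)
    show "?g ` {0..1} \<subseteq> {0..1}"
      by (rule affine_image_subset_unit[OF assms(3,5)])
  qed (auto simp: joinpaths_def intro!: continuous_intros)
  moreover have "p \<circ> ?f = restrict_path r s p +++ restrict_path s t p"
    by (auto simp: joinpaths_def restrict_path_def)
  ultimately show ?thesis by (simp add: restrict_path_compose)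
qed

lemma join_reversepath_homotopic:
  fixes p :: "real \<Rightarrow> 'a::topological_space"
  assumes "path p" "path_image p \<subseteq> X"
  shows "homotopic_paths X (p +++ reversepath p) (\<lambda>_. pathstart p)"
  using reversepath_join_homotopic[of "reversepath p" X "pathstart p"] assms by simp

lemma join_cancel_left:
  fixes p q :: "real \<Rightarrow> 'a::topological_space"
  assumes "path p" "path_image p \<subseteq> X" "path q" "path_image q \<subseteq> X" "pathstart q = pathstart p"
  shows "homotopic_paths X (p +++ (reversepath p +++ q)) q"
proof -
  have "homotopic_paths X (p +++ (reversepath p +++ q)) ((p +++ reversepath p) +++ q)"
    using assms by (intro homotopic_paths_assoc) auto
  also have "homotopic_paths X \<dots> ((\<lambda>_. pathstart p) +++ q)"
    using assms by (intro homotopic_paths_join join_reversepath_homotopic) auto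
  also have "homotopic_paths X \<dots> q"
    using assms by (intro const_join_homotopic) auto
  finally show ?thesis .
qed

lemma join_cancel_right:
  fixes p q :: "real \<Rightarrow> 'a::topological_space"
  assumes "path p" "path_image p \<subseteq> X" "path q" "path_image q \<subseteq> X" "pathfinish p = pathstart q"
  shows "homotopic_paths X ((p +++ q) +++ reversepath q) p"
proof -
  have "homotopic_paths X ((p +++ q) +++ reversepath q) (p +++ (q +++ reversepath q))"
    using assms by (intro homotopic_paths_sym[OF homotopic_paths_assoc]) auto
  also have "homotopic_paths X \<dots> (p +++ (\<lambda>_. pathstart q))"
    using assms by (intro homotopic_paths_join join_reversepath_homotopic) auto
  also have "homotopic_paths X \<dots> p"
    using assms by (intro right_const_homotopic) auto
  finally show ?thesis .
qed

subsection \<open>The right action of paths on H-classes\<close>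

locale path_subgroup =
  fixes X :: "'a::topological_space set" and x0 :: 'a and H :: "(real \<Rightarrow> 'a) set set"
  assumes base_in: "x0 \<in> X" and subgroup_H: "subgroup H (fundamental_group X x0)"
begin

abbreviation G where "G \<equiv> fundamental_group X x0"

abbreviation P where "P \<equiv> paths_from X x0"

abbreviation cls where "cls \<equiv> H_class X x0 H"

definition hrel :: "(real \<Rightarrow> 'a) \<Rightarrow> (real \<Rightarrow> 'a) \<Rightarrow> bool" where
  "hrel \<phi> \<psi> \<longleftrightarrow> (\<phi>, \<psi>) \<in> H_related X x0 H"

lemma group_G: "group G"
  using group_fundamental_group[OF base_in] .

definition quot :: "(real \<Rightarrow> 'a) \<Rightarrow> (real \<Rightarrow> 'a) \<Rightarrow> (real \<Rightarrow> 'a) set" where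
  "quot \<phi> \<psi> = path_class X (\<phi> +++ reversepath \<psi>)"

lemma P_iff: "\<phi> \<in> P \<longleftrightarrow> path \<phi> \<and> path_image \<phi> \<subseteq> X \<and> pathstart \<phi> = x0"
  by (auto simp: paths_from_def)

lemma P_join: "\<phi> \<in> P \<Longrightarrow> path r \<Longrightarrow> path_image r \<subseteq> X \<Longrightarrow> pathstart r = pathfinish \<phi> \<Longrightarrow> \<phi> +++ r \<in> P"
  by (auto simp: P_iff subset_path_image_join)

lemma P_restrict: "\<phi> \<in> P \<Longrightarrow> t \<in> {0..1} \<Longrightarrow> restrict_path 0 t \<phi> \<in> P"
  by (simp add: P_iff path_restrict_path path_image_restrict_path_subset) (simp add: pathstart_def)

lemma quot_loop:
  "\<phi> \<in> P \<Longrightarrow> \<psi> \<in> P \<Longrightarrow> pathfinish \<phi> = pathfinish \<psi> \<Longrightarrow> \<phi> +++ reversepath \<psi> \<in> loops_at X x0"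
  by (auto simp: P_iff loops_at_iff subset_path_image_join)

lemma quot_carrier:
  "\<phi> \<in> P \<Longrightarrow> \<psi> \<in> P \<Longrightarrow> pathfinish \<phi> = pathfinish \<psi> \<Longrightarrow> quot \<phi> \<psi> \<in> carrier G"
  using quot_loop by (auto simp: quot_def fundamental_group_def)

lemma quot_self: "\<phi> \<in> P \<Longrightarrow> quot \<phi> \<phi> = \<one>\<^bsub>G\<^esub>"
  using join_reversepath_homotopic[of \<phi> X]
  by (auto simp: quot_def P_iff fundamental_group_def intro!: path_class_eq)

text \<open>The two inner copies of \<psi> cancel. With this cocycle identity the equivalence
  relation laws for \<open>hrel\<close> become closure of H under unit, inverse and product.\<close>

lemma quot_mult:
  assumes "\<phi> \<in> P" "\<psi> \<in> P" "\<theta> \<in> P" "pathfinish \<phi> = pathfinish \<psi>" "pathfinish \<psi> = pathfinish \<theta>"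
  shows "quot \<phi> \<psi> \<otimes>\<^bsub>G\<^esub> quot \<psi> \<theta> = quot \<phi> \<theta>"
proof -
  have "homotopic_paths X ((\<phi> +++ reversepath \<psi>) +++ (\<psi> +++ reversepath \<theta>))
          (\<phi> +++ (reversepath \<psi> +++ (\<psi> +++ reversepath \<theta>)))"
    using assms by (intro homotopic_paths_sym[OF homotopic_paths_assoc])
      (auto simp: P_iff subset_path_image_join)
  also have "homotopic_paths X \<dots> (\<phi> +++ reversepath \<theta>)"
    using assms join_cancel_left[of "reversepath \<psi>" X "reversepath \<theta>"]
    by (intro homotopic_paths_join) (auto simp: P_iff)
  finally show ?thesis
    using assms by (simp add: quot_def fundamental_group_mult quot_loop path_class_eq)
qed

lemma quot_inv:
  assumes "\<phi> \<in> P" "\<psi> \<in> P" "pathfinish \<phi> = pathfinish \<psi>"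
  shows "quot \<psi> \<phi> = inv\<^bsub>G\<^esub> quot \<phi> \<psi>"
  using assms quot_mult[of \<psi> \<phi> \<psi>] quot_self
  by (intro group.inv_equality[OF group_G, symmetric]) (auto simp: quot_carrier)

text \<open>The common tail \<open>r\<close> retraces itself and cancels, so appending a path is a
  well-defined right action on H-classes.\<close>

lemma quot_join:
  assumes "\<phi> \<in> P" "\<psi> \<in> P" "pathfinish \<phi> = pathfinish \<psi>"
    "path r" "path_image r \<subseteq> X" "pathstart r = pathfinish \<phi>"
  shows "quot (\<phi> +++ r) (\<psi> +++ r) = quot \<phi> \<psi>"
proof -
  have eq: "reversepath (\<psi> +++ r) = reversepath r +++ reversepath \<psi>"
    using assms by (intro reversepath_joinpaths) auto
  have "homotopic_paths X ((\<phi> +++ r) +++ (reversepath r +++ reversepath \<psi>))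
         (((\<phi> +++ r) +++ reversepath r) +++ reversepath \<psi>)"
    using assms by (intro homotopic_paths_assoc) (auto simp: P_iff subset_path_image_join)
  also have "homotopic_paths X \<dots> (\<phi> +++ reversepath \<psi>)"
    using assms by (intro homotopic_paths_join join_cancel_right) (auto simp: P_iff)
  finally show ?thesis by (simp add: quot_def eq path_class_eq)
qed

lemma hrel_iff:
  "hrel \<phi> \<psi> \<longleftrightarrow> \<phi> \<in> P \<and> \<psi> \<in> P \<and> pathfinish \<phi> = pathfinish \<psi> \<and> quot \<phi> \<psi> \<in> H"
  by (auto simp: hrel_def H_related_def quot_def)

lemma hrel_refl: "\<phi> \<in> P \<Longrightarrow> hrel \<phi> \<phi>"
  using subgroup.one_closed[OF subgroup_H] by (auto simp: hrel_iff quot_self)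

lemma hrel_sym: "hrel \<phi> \<psi> \<Longrightarrow> hrel \<psi> \<phi>"
  using subgroup.m_inv_closed[OF subgroup_H] by (auto simp: hrel_iff quot_inv[of \<phi> \<psi>])

lemma hrel_trans [trans]: "hrel \<phi> \<psi> \<Longrightarrow> hrel \<psi> \<theta> \<Longrightarrow> hrel \<phi> \<theta>"
  using subgroup.m_closed[OF subgroup_H] by (auto simp: hrel_iff quot_mult[of \<phi> \<psi> \<theta>, symmetric])

lemma hrel_join:
  assumes "hrel \<phi> \<psi>" "path r" "path_image r \<subseteq> X" "pathstart r = pathfinish \<phi>"
  shows "hrel (\<phi> +++ r) (\<psi> +++ r)"
  using assms by (auto simp: hrel_iff quot_join intro!: P_join)

lemma hrel_homotopic:
  assumes "homotopic_paths X \<phi> \<psi>" "\<phi> \<in> P"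
  shows "hrel \<phi> \<psi>"
proof -
  have "\<psi> \<in> P" "pathfinish \<phi> = pathfinish \<psi>"
    using homotopic_paths_imp_path[OF assms(1)] homotopic_paths_imp_subset[OF assms(1)]
      homotopic_paths_imp_pathstart[OF assms(1)] homotopic_paths_imp_pathfinish[OF assms(1)] assms(2)
    by (auto simp: P_iff)
  moreover have "quot \<phi> \<psi> = quot \<psi> \<psi>"
    using assms calculation unfolding quot_def
    by (intro path_class_eq homotopic_paths_join) (auto simp: P_iff)
  ultimately show ?thesis
    using hrel_refl[of \<psi>] assms by (auto simp: hrel_iff)
qed

lemma cls_eq_iff: "\<phi> \<in> P \<Longrightarrow> \<psi> \<in> P \<Longrightarrow> cls \<phi> = cls \<psi> \<longleftrightarrow> hrel \<phi> \<psi>"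
  unfolding H_class_def using hrel_refl hrel_sym hrel_trans unfolding hrel_def by blast

text \<open>Replacing the approach path \<phi> by \<psi> conjugates the class of the loop by
  \<open>quot \<psi> \<phi>\<close>, so normality keeps it in H.\<close>

lemma hrel_normal_loop:
  assumes "H \<lhd> G" "hrel (\<phi> +++ r) \<phi>" "\<phi> \<in> P" "\<psi> \<in> P" "pathfinish \<psi> = pathfinish \<phi>"
    "path r" "path_image r \<subseteq> X" "pathstart r = pathfinish \<phi>"
  shows "hrel (\<psi> +++ r) \<psi>"
proof -
  have r: "pathfinish r = pathfinish \<phi>"
    using assms(2) by (auto simp: hrel_iff)
  have P: "\<psi> +++ r \<in> P" "\<phi> +++ r \<in> P" using assms by (auto intro: P_join)
  have "quot (\<psi> +++ r) \<psi> = quot (\<psi> +++ r) (\<phi> +++ r) \<otimes>\<^bsub>G\<^esub> (quot (\<phi> +++ r) \<phi> \<otimes>\<^bsub>G\<^esub> quot \<phi> \<psi>)"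
    using assms r P by (simp add: quot_mult)
  also have "\<dots> = quot \<psi> \<phi> \<otimes>\<^bsub>G\<^esub> (quot (\<phi> +++ r) \<phi> \<otimes>\<^bsub>G\<^esub> inv\<^bsub>G\<^esub> (quot \<psi> \<phi>))"
    using assms by (simp add: quot_join quot_inv[of \<psi> \<phi>])
  also have "\<dots> = quot \<psi> \<phi> \<otimes>\<^bsub>G\<^esub> quot (\<phi> +++ r) \<phi> \<otimes>\<^bsub>G\<^esub> inv\<^bsub>G\<^esub> (quot \<psi> \<phi>)"
    using assms r P quot_carrier[of \<psi> \<phi>] quot_carrier[of "\<phi> +++ r" \<phi>] group_G
    by (simp add: group.is_monoid monoid.m_assoc)
  also have "\<dots> \<in> H"
    using assms quot_carrier[of \<psi> \<phi>] by (intro normal.inv_op_closed2) (auto simp: hrel_iff)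
  finally show ?thesis using assms r P by (auto simp: hrel_iff)
qed

text \<open>The tail can be absorbed into the path inside U that defines membership. Continuity into
  the space of classes thus reduces to finding connecting paths inside U.\<close>

lemma basic_nbhd_join:
  assumes "\<phi> \<in> P" "\<sigma> \<in> P" "cls \<phi> \<in> basic_nbhd X x0 H \<sigma> U"
    "path r" "path_image r \<subseteq> X" "path_image r \<subseteq> U" "pathstart r = pathfinish \<phi>"
  shows "cls (\<phi> +++ r) \<in> basic_nbhd X x0 H \<sigma> U"
proof -
  obtain e where e: "cls \<phi> = cls (\<sigma> +++ e)" "path e" "path_image e \<subseteq> X" "path_image e \<subseteq> U"
    "pathstart e = pathfinish \<sigma>"
    using assms(3) by (auto simp: basic_nbhd_def paths_from_def)
  have Pe: "\<sigma> +++ e \<in> P" using e assms by (auto intro: P_join)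
  then have h: "hrel \<phi> (\<sigma> +++ e)" using assms e cls_eq_iff by blast
  then have fin: "pathfinish e = pathfinish \<phi>" by (auto simp: hrel_iff)
  have "hrel (\<phi> +++ r) ((\<sigma> +++ e) +++ r)"
    using h assms by (intro hrel_join) auto
  moreover have "hrel ((\<sigma> +++ e) +++ r) (\<sigma> +++ (e +++ r))"
    using e assms fin Pe
    by (intro hrel_homotopic homotopic_paths_sym[OF homotopic_paths_assoc] P_join) (auto simp: P_iff)
  ultimately have "hrel (\<phi> +++ r) (\<sigma> +++ (e +++ r))" by (rule hrel_trans)
  then have "cls (\<phi> +++ r) = cls (\<sigma> +++ (e +++ r))"
    by (subst cls_eq_iff) (auto simp: hrel_iff)
  moreover have "e +++ r \<in> paths_from X (pathfinish \<sigma>)" "path_image (e +++ r) \<subseteq> U"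
    using e assms fin by (auto simp: paths_from_def subset_path_image_join)
  ultimately show ?thesis unfolding basic_nbhd_def by blast
qed

lemma cls_in_basic_nbhd:
  assumes "\<phi> \<in> P" "pathfinish \<phi> \<in> U"
  shows "cls \<phi> \<in> basic_nbhd X x0 H \<phi> U"
proof -
  have X: "pathfinish \<phi> \<in> X" using assms pathfinish_in_path_image by (auto simp: P_iff)
  have "homotopic_paths X (\<phi> +++ (\<lambda>_. pathfinish \<phi>)) \<phi>"
    using assms by (intro right_const_homotopic) (auto simp: P_iff)
  from H_class_cong[OF this] have "cls \<phi> = cls (\<phi> +++ (\<lambda>_. pathfinish \<phi>))" by (rule sym)
  moreover have "(\<lambda>_. pathfinish \<phi>) \<in> paths_from X (pathfinish \<phi>)"
    using X by (auto simp: paths_from_def)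
  ultimately show ?thesis using assms unfolding basic_nbhd_def by auto
qed

lemma hrel_assoc:
  assumes "\<phi> \<in> P" "path q" "path_image q \<subseteq> X" "path r" "path_image r \<subseteq> X"
    "pathfinish \<phi> = pathstart q" "pathfinish q = pathstart r"
  shows "hrel ((\<phi> +++ q) +++ r) (\<phi> +++ (q +++ r))"
  using assms
  by (intro hrel_homotopic homotopic_paths_sym[OF homotopic_paths_assoc] P_join) (auto simp: P_iff)

lemma hrel_join_homotopic:
  assumes "\<phi> \<in> P" "homotopic_paths X q r" "pathfinish \<phi> = pathstart q"
  shows "hrel (\<phi> +++ q) (\<phi> +++ r)"
  using assms homotopic_paths_imp_path[OF assms(2)] homotopic_paths_imp_subset[OF assms(2)]
  by (intro hrel_homotopic homotopic_paths_join P_join) (auto simp: P_iff)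

end

subsection \<open>Unique path lifting implies transfinite products\<close>

definition last_in :: "real set \<Rightarrow> real \<Rightarrow> real" where
  "last_in A t = Sup (A \<inter> {0..t})"

lemma last_in:
  assumes "closed A" "0 \<in> A" "0 \<le> t"
  shows "last_in A t \<in> A" "0 \<le> last_in A t" "last_in A t \<le> t"
    "\<And>x. x \<in> A \<Longrightarrow> 0 \<le> x \<Longrightarrow> x \<le> t \<Longrightarrow> x \<le> last_in A t"
proof -
  have "compact (A \<inter> {0..t})"
    using assms(1) by (intro closed_Int_compact) auto
  moreover have "A \<inter> {0..t} \<noteq> {}" using assms by auto
  ultimately obtain m where m: "m \<in> A \<inter> {0..t}" "\<forall>x\<in>A \<inter> {0..t}. x \<le> m"
    using compact_attains_sup by blast
  then have "last_in A t = m"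
    unfolding last_in_def by (intro cSup_eq_maximum) auto
  with m show "last_in A t \<in> A" "0 \<le> last_in A t" "last_in A t \<le> t"
    "\<And>x. x \<in> A \<Longrightarrow> 0 \<le> x \<Longrightarrow> x \<le> t \<Longrightarrow> x \<le> last_in A t"
    by auto
qed

lemma last_in_self:
  assumes "closed A" "0 \<in> A" "t \<in> A" "0 \<le> t"
  shows "last_in A t = t"
  using last_in(3,4)[OF assms(1,2,4)] assms by (meson antisym order_refl)

text \<open>A connected set of reals that contains (a,b) and leaves it must contain a or b, which
  are excluded. This turns gaps found by supremum and infimum into the components that occur in the
  product hypothesis.\<close>

lemma gap_in_components:
  fixes A :: "real set"
  assumes "A \<subseteq> {0..1}" "a \<in> A" "b \<in> A" "a < b" "{a<..<b} \<inter> A = {}"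
  shows "{a<..<b} \<in> components ({0..1} - A)"
  unfolding in_components_maximal
proof (intro conjI allI impI)
  show "{a<..<b} \<noteq> {}" using assms(4) by simp
  show "{a<..<b} \<subseteq> {0..1} - A" using assms by force
  fix d assume d: "d \<noteq> {} \<and> {a<..<b} \<subseteq> d \<and> d \<subseteq> {0..1} - A \<and> connected d"
  have "a \<notin> d" "b \<notin> d" using d assms by auto
  have mid: "(a + b) / 2 \<in> d" using d assms(4) by (auto simp: subset_eq)
  have "d \<subseteq> {a<..<b}"
  proof
    fix x assume x: "x \<in> d"
    have "\<not> x \<le> a"
      using connectedD_interval[of d x "(a+b)/2" a] d x mid \<open>a \<notin> d\<close> assms(4) by auto
    moreover have "\<not> b \<le> x"
      using connectedD_interval[of d "(a+b)/2" x b] d x mid \<open>b \<notin> d\<close> assms(4) by auto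
    ultimately show "x \<in> {a<..<b}" by auto
  qed
  then show "d = {a<..<b}" using d by blast
qed (rule connected_Ioo)

section \<open>The switched lift and its continuity\<close>

context path_subgroup
begin

definition switch_path :: "real set \<Rightarrow> (real \<Rightarrow> 'a) \<Rightarrow> (real \<Rightarrow> 'a) \<Rightarrow> real \<Rightarrow> real \<Rightarrow> 'a" where
  "switch_path A \<alpha> \<beta> t = restrict_path 0 (last_in A t) \<alpha> +++ restrict_path (last_in A t) t \<beta>"

context
  fixes A \<alpha> \<beta>
  assumes clA: "closed A" and A01: "A \<subseteq> {0..1}" and A0: "0 \<in> A" and A1: "1 \<in> A"
    and \<alpha>: "\<alpha> \<in> P" and \<beta>: "\<beta> \<in> P" and agree: "\<And>t. t \<in> A \<Longrightarrow> \<alpha> t = \<beta> t"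
    and gaps: "\<And>a b. {a<..<b} \<in> components ({0..1} - A) \<Longrightarrow> a \<in> A \<Longrightarrow> b \<in> A \<Longrightarrow> a < b \<Longrightarrow>
                  hrel (restrict_path 0 b \<alpha>) (restrict_path 0 a \<alpha> +++ restrict_path a b \<beta>)"
begin

lemma restrict_\<alpha>:
  assumes "s \<in> {0..1}" "t \<in> {0..1}"
  shows "path (restrict_path s t \<alpha>)" "path_image (restrict_path s t \<alpha>) \<subseteq> X"
  using assms \<alpha> by (simp_all only: P_iff path_restrict_path path_image_restrict_path_subset)

lemma restrict_\<beta>:
  assumes "s \<in> {0..1}" "t \<in> {0..1}"
  shows "path (restrict_path s t \<beta>)" "path_image (restrict_path s t \<beta>) \<subseteq> X"
  using assms \<beta> by (simp_all only: P_iff path_restrict_path path_image_restrict_path_subset)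

lemma switch_path_P:
  assumes "t \<in> {0..1}"
  shows "switch_path A \<alpha> \<beta> t \<in> P" "pathfinish (switch_path A \<alpha> \<beta> t) = \<beta> t"
proof -
  have l: "last_in A t \<in> {0..1}" "\<alpha> (last_in A t) = \<beta> (last_in A t)"
    using last_in[OF clA A0, of t] assms agree[of "last_in A t"] by auto
  show "switch_path A \<alpha> \<beta> t \<in> P"
    unfolding switch_path_def using \<alpha> l assms
    by (intro P_join P_restrict restrict_\<beta>) simp_all
  show "pathfinish (switch_path A \<alpha> \<beta> t) = \<beta> t"
    by (simp add: switch_path_def)
qed

text \<open>Let b be the first point of A from s on and a' the last one up to t. The connecting path
  follows \<beta> to b, \<alpha> to a' and \<beta> to t. However many gaps lie between b and a',
  only the one around s is crossed by the hypothesis, because \<open>switch_path\<close> itself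
  follows \<alpha> up to a'. The bound on the image records that \<alpha> is visited only if A meets
  [s,t]; continuity away from A depends on this.\<close>

lemma switch_path_step:
  assumes st: "0 \<le> s" "s \<le> t" "t \<le> 1"
  shows "\<exists>e. path e \<and> path_image e \<subseteq> X \<and> pathstart e = \<beta> s \<and> pathfinish e = \<beta> t \<and>
           path_image e \<subseteq> \<beta> ` {s..t} \<union> (if A \<inter> {s..t} = {} then {} else \<alpha> ` {s..t}) \<and>
           hrel (switch_path A \<alpha> \<beta> s +++ e) (switch_path A \<alpha> \<beta> t)"
proof -
  define a a' where "a = last_in A s" and "a' = last_in A t"
  have a: "a \<in> A" "0 \<le> a" "a \<le> s" "\<And>x. x \<in> A \<Longrightarrow> x \<le> s \<Longrightarrow> x \<le> a"
    using last_in[OF clA A0 st(1)] A01 by (auto simp: a_def)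
  have a': "a' \<in> A" "0 \<le> a'" "a' \<le> t" "\<And>x. x \<in> A \<Longrightarrow> x \<le> t \<Longrightarrow> x \<le> a'"
    using last_in[OF clA A0, of t] A01 st by (auto simp: a'_def)
  note sw = switch_path_def[of A \<alpha> \<beta> s, folded a_def] switch_path_def[of A \<alpha> \<beta> t, folded a'_def]
  have ag: "\<alpha> a = \<beta> a" "\<alpha> a' = \<beta> a'" using a a' agree by auto
  have I: "a \<in> {0..1}" "a' \<in> {0..1}" "s \<in> {0..1}" "t \<in> {0..1}" "(0::real) \<in> {0..1}" using a a' st by auto
  have \<beta>': "path \<beta>" "path_image \<beta> \<subseteq> X" and \<alpha>': "path \<alpha>" "path_image \<alpha> \<subseteq> X"
    using \<alpha> \<beta> by (auto simp: P_iff)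
  have Pa: "restrict_path 0 a \<alpha> \<in> P" "restrict_path 0 a' \<alpha> \<in> P" using \<alpha> I by (auto intro: P_restrict)
  show ?thesis
  proof (cases "a = a'")
    \<comment> \<open>No point of A lies in (s,t], so continuing along \<beta> is enough.\<close>
    case True
    have "hrel (switch_path A \<alpha> \<beta> s +++ restrict_path s t \<beta>)
            (restrict_path 0 a \<alpha> +++ (restrict_path a s \<beta> +++ restrict_path s t \<beta>))"
      unfolding sw using Pa I ag by (intro hrel_assoc restrict_\<beta>) auto
    moreover have "hrel (restrict_path 0 a \<alpha> +++ (restrict_path a s \<beta> +++ restrict_path s t \<beta>))
        (switch_path A \<alpha> \<beta> t)"
      unfolding sw True[symmetric]
      using Pa I ag \<beta>' by (intro hrel_join_homotopic restrict_path_join_homotopic) auto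
    ultimately have "hrel (switch_path A \<alpha> \<beta> s +++ restrict_path s t \<beta>) (switch_path A \<alpha> \<beta> t)"
      by (rule hrel_trans)
    moreover have "path_image (restrict_path s t \<beta>) \<subseteq> \<beta> ` {s..t}"
      using path_image_restrict_path[OF I(3,4), of \<beta>] st by auto
    ultimately show ?thesis
      using restrict_\<beta>[OF I(3,4)] by (intro exI[of _ "restrict_path s t \<beta>"]) auto
  next
    case False
    have "a \<le> a'" using a a' st by (meson order_trans)
    with False have "a < a'" by simp
    then have sa': "s < a'" using a a'(1) by (meson not_le)
    have "compact (A \<inter> {s..1})" using clA by (intro closed_Int_compact) auto
    moreover have "A \<inter> {s..1} \<noteq> {}" using A1 st by auto
    ultimately obtain b where b: "b \<in> A \<inter> {s..1}" "\<And>x. x\<in>A \<inter> {s..1} \<Longrightarrow> b \<le> x"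
      using compact_attains_inf by metis
    have ba': "b \<le> a'" using b(2)[of a'] a' sa' st by auto
    have I': "b \<in> {0..1}" using b st by auto
    have agb: "\<alpha> b = \<beta> b" using b agree by auto
    have Pb: "restrict_path 0 b \<alpha> \<in> P" using \<alpha> I' by (auto intro: P_restrict)
    have ab: "hrel (restrict_path 0 a \<alpha> +++ restrict_path a b \<beta>) (restrict_path 0 b \<alpha>)"
    proof (cases "a = b")
      \<comment> \<open>Here s itself belongs to A and there is no gap to cross.\<close>
      case True
      have "homotopic_paths X (restrict_path 0 a \<alpha> +++ restrict_path a a \<beta>) (restrict_path 0 a \<alpha>)"
        using Pa ag by (auto simp: restrict_path_refl P_iff intro!: right_const_homotopic)
      then show ?thesis using True Pa I ag
        by (auto intro!: hrel_homotopic P_join restrict_\<beta>(1) restrict_\<beta>(2)[THEN subsetD])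
    next
      case ne: False
      have "a < b" using a b ne by auto
      moreover have "{a<..<b} \<inter> A = {}"
      proof -
        have "x \<le> a \<or> b \<le> x" if "x \<in> A" for x
          using a(4)[OF that] b(2)[of x] that A01 by fastforce
        then show ?thesis by force
      qed
      ultimately show ?thesis
        using gaps[OF gap_in_components, of a b] A01 a b by (auto intro: hrel_sym)
    qed
    define E where "E = restrict_path b a' \<alpha> +++ restrict_path a' t \<beta>"
    define e where "e = restrict_path s b \<beta> +++ E"
    have E: "path E" "path_image E \<subseteq> X" "pathstart E = \<beta> b" "pathfinish E = \<beta> t"
      using I I' ag agb unfolding E_def
      by (simp_all add: restrict_\<alpha> restrict_\<beta> subset_path_image_join)
    have e: "path e" "path_image e \<subseteq> X" "pathstart e = \<beta> s" "pathfinish e = \<beta> t"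
      using I I' E unfolding e_def
      by (simp_all add: restrict_\<beta> subset_path_image_join)
    have "path_image e \<subseteq> \<beta> ` {s..t} \<union> \<alpha> ` {s..t}"
    proof -
      have "path_image (restrict_path s b \<beta>) \<subseteq> \<beta> ` {s..t}"
        using path_image_restrict_path[OF I(3) I', of \<beta>] b ba' a'
        by (intro subset_trans[OF path_image_restrict_path[OF I(3) I']] image_mono) auto
      moreover have "path_image (restrict_path b a' \<alpha>) \<subseteq> \<alpha> ` {s..t}"
        using b ba' a'
        by (intro subset_trans[OF path_image_restrict_path[OF I' I(2)]] image_mono) auto
      moreover have "path_image (restrict_path a' t \<beta>) \<subseteq> \<beta> ` {s..t}"
        using sa' a'
        by (intro subset_trans[OF path_image_restrict_path[OF I(2,4)]] image_mono) auto
      ultimately show ?thesis unfolding e_def E_def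
        by (intro subset_path_image_join) auto
    qed
    moreover have "A \<inter> {s..t} \<noteq> {}" using a' sa' by auto
    moreover have "hrel (switch_path A \<alpha> \<beta> s +++ e) (switch_path A \<alpha> \<beta> t)"
    proof -
      let ?r = "restrict_path 0 a \<alpha>"
      have PP: "?r +++ restrict_path a s \<beta> \<in> P" "?r +++ restrict_path a b \<beta> \<in> P"
        "restrict_path 0 b \<alpha> +++ restrict_path b a' \<alpha> \<in> P"
        using Pa Pb I I' ag by (simp_all add: P_join restrict_\<alpha> restrict_\<beta>)
      have "hrel ((?r +++ restrict_path a s \<beta>) +++ (restrict_path s b \<beta> +++ E))
              (((?r +++ restrict_path a s \<beta>) +++ restrict_path s b \<beta>) +++ E)"
        using PP I I' E ag by (intro hrel_sym[OF hrel_assoc] restrict_\<beta>) auto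
      moreover have "hrel \<dots> ((?r +++ (restrict_path a s \<beta> +++ restrict_path s b \<beta>)) +++ E)"
        using Pa I I' E ag by (intro hrel_join[OF hrel_assoc] restrict_\<beta>) auto
      moreover have "hrel \<dots> ((?r +++ restrict_path a b \<beta>) +++ E)"
        using Pa I I' E ag \<beta>'
        by (intro hrel_join[OF hrel_join_homotopic] restrict_path_join_homotopic) auto
      moreover have "hrel \<dots> (restrict_path 0 b \<alpha> +++ E)"
        using ab E by (intro hrel_join) auto
      moreover have "hrel \<dots> ((restrict_path 0 b \<alpha> +++ restrict_path b a' \<alpha>) +++ restrict_path a' t \<beta>)"
        unfolding E_def
        using Pb I I' ag by (intro hrel_sym[OF hrel_assoc] restrict_\<beta> restrict_\<alpha>) auto
      moreover have "hrel \<dots> (restrict_path 0 a' \<alpha> +++ restrict_path a' t \<beta>)"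
        using Pb I I' ag \<alpha>' PP restrict_\<beta>[OF I(2,4)]
        by (intro hrel_join[OF hrel_homotopic] restrict_path_join_homotopic) auto
      ultimately show ?thesis unfolding sw e_def by (meson hrel_trans)
    qed
    ultimately show ?thesis using e by (intro exI[of _ e]) auto
  qed
qed

lemma switch_path_step_sym:
  assumes "s \<in> {0..1}" "t \<in> {0..1}"
  shows "\<exists>e. path e \<and> path_image e \<subseteq> X \<and> pathstart e = \<beta> s \<and> pathfinish e = \<beta> t \<and>
           path_image e \<subseteq> \<beta> ` {min s t..max s t} \<union>
             (if A \<inter> {min s t..max s t} = {} then {} else \<alpha> ` {min s t..max s t}) \<and>
           hrel (switch_path A \<alpha> \<beta> s +++ e) (switch_path A \<alpha> \<beta> t)"
proof (cases "s \<le> t")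
  case True
  then have "min s t = s" "max s t = t" by auto
  then show ?thesis using switch_path_step[of s t] assms True by (simp only: atLeastAtMost_iff)
next
  case False
  then obtain e where e: "path e" "path_image e \<subseteq> X" "pathstart e = \<beta> t" "pathfinish e = \<beta> s"
    "path_image e \<subseteq> \<beta> ` {t..s} \<union> (if A \<inter> {t..s} = {} then {} else \<alpha> ` {t..s})"
    "hrel (switch_path A \<alpha> \<beta> t +++ e) (switch_path A \<alpha> \<beta> s)"
    using switch_path_step[of t s] assms by (metis atLeastAtMost_iff linear)
  have mm: "min s t = t" "max s t = s" using False by auto
  note sw = switch_path_P[OF assms(1)] switch_path_P[OF assms(2)]
  have "hrel (switch_path A \<alpha> \<beta> s +++ reversepath e) ((switch_path A \<alpha> \<beta> t +++ e) +++ reversepath e)"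
    using e sw by (intro hrel_join hrel_sym[OF e(6)]) auto
  moreover have "hrel \<dots> (switch_path A \<alpha> \<beta> t)"
    using e sw by (intro hrel_homotopic join_cancel_right P_join) (auto simp: P_iff)
  ultimately have "hrel (switch_path A \<alpha> \<beta> s +++ reversepath e) (switch_path A \<alpha> \<beta> t)"
    by (rule hrel_trans)
  then show ?thesis using e unfolding mm by (intro exI[of _ "reversepath e"]) simp
qed

lemma switch_path_continuous:
  "pathin (path_cover X x0 H) (\<lambda>t. cls (switch_path A \<alpha> \<beta> t))"
  unfolding pathin_def path_cover_def
proof (rule continuous_on_generated_topo)
  let ?g = "\<lambda>t. cls (switch_path A \<alpha> \<beta> t)"
  have cont: "continuous_on {0..1} \<alpha>" "continuous_on {0..1} \<beta>"
    using \<alpha> \<beta> by (auto simp: P_iff path_def)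
  fix B assume "B \<in> {basic_nbhd X x0 H \<alpha> U |\<alpha> U. \<alpha> \<in> P \<and> openin (top_of_set X) U \<and> pathfinish \<alpha> \<in> U}"
  then obtain \<sigma> U where B: "B = basic_nbhd X x0 H \<sigma> U" "\<sigma> \<in> P" "openin (top_of_set X) U"
    by blast
  have op: "openin (top_of_set {0..1}) ({0..1} \<inter> f -` U)" if "f \<in> P" for f :: "real \<Rightarrow> 'a"
    using that B(3) by (intro continuous_openin_preimage[of _ _ X]) (auto simp: P_iff path_def path_image_def)
  have "\<exists>d>0. \<forall>s\<in>{0..1}. dist s t < d \<longrightarrow> ?g s \<in> B" if t: "t \<in> {0..1}" "?g t \<in> B" for t
  proof -
    have ex: "\<exists>d>0. \<forall>s\<in>{0..1}. dist s t < d \<longrightarrow> f s \<in> U" if "f \<in> P" "f t \<in> U" for f :: "real \<Rightarrow> 'a"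
      using op[OF that(1)] that(2) t(1) unfolding openin_euclidean_subtopology_iff by force
    \<comment> \<open>B is centred at \<sigma>, not at the class at time t; equality of classes
      still forces \<beta> t, as the end of a path inside U, to lie in U.\<close>
    obtain e0 where e0: "cls (switch_path A \<alpha> \<beta> t) = cls (\<sigma> +++ e0)"
      "e0 \<in> paths_from X (pathfinish \<sigma>)" "path_image e0 \<subseteq> U"
      using t B by (auto simp: basic_nbhd_def)
    have "\<sigma> +++ e0 \<in> P" using e0 B by (intro P_join) (simp_all add: paths_from_def)
    then have "hrel (switch_path A \<alpha> \<beta> t) (\<sigma> +++ e0)"
      using e0 switch_path_P[OF t(1)] by (subst cls_eq_iff[symmetric]) auto
    then have "\<beta> t = pathfinish e0" using switch_path_P[OF t(1)] by (auto simp: hrel_iff)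
    then have \<beta>U: "\<beta> t \<in> U" using e0 pathfinish_in_path_image by auto
    then obtain d where d: "d > 0" "\<And>s. s\<in>{0..1} \<Longrightarrow> dist s t < d \<Longrightarrow> \<beta> s \<in> U"
      using ex[OF \<beta>] by blast
    \<comment> \<open>If t is in A, then \<alpha> t = \<beta> t lies in U and \<alpha> stays there
      nearby. If not, closedness keeps A away from t, and \<alpha> is not visited at all.\<close>
    have "\<exists>d'>0. \<forall>s\<in>{0..1}. dist s t < d' \<longrightarrow> A \<inter> {min t s..max t s} \<noteq> {} \<longrightarrow>
            \<alpha> ` {min t s..max t s} \<subseteq> U"
    proof (cases "t \<in> A")
      case True
      then obtain d' where d': "d' > 0" "\<And>s. s\<in>{0..1} \<Longrightarrow> dist s t < d' \<Longrightarrow> \<alpha> s \<in> U"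
        using ex[OF \<alpha>] \<beta>U agree by auto
      have "\<alpha> x \<in> U" if "s \<in> {0..1}" "dist s t < d'" "x \<in> {min t s..max t s}" for s x
        using that t(1) by (intro d'(2)) (auto simp: dist_real_def min_def max_def split: if_splits)
      then show ?thesis using d'(1) by blast
    next
      case False
      then obtain d' where "d' > 0" "ball t d' \<subseteq> - A"
        using clA by (meson ComplI open_Compl open_contains_ball)
      moreover have "x \<in> ball t d'" if "dist s t < d'" "x \<in> {min t s..max t s}" for s x
        using that by (auto simp: dist_real_def min_def max_def split: if_splits)
      ultimately show ?thesis by blast
    qed
    then obtain d' where d': "d' > 0"
      "\<And>s. s\<in>{0..1} \<Longrightarrow> dist s t < d' \<Longrightarrow> A \<inter> {min t s..max t s} \<noteq> {} \<Longrightarrow>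
            \<alpha> ` {min t s..max t s} \<subseteq> U"
      by blast
    have "?g s \<in> B" if s: "s \<in> {0..1}" "dist s t < min d d'" for s
    proof -
      obtain e where e: "path e" "path_image e \<subseteq> X" "pathstart e = \<beta> t" "pathfinish e = \<beta> s"
        "path_image e \<subseteq> \<beta> ` {min t s..max t s} \<union>
             (if A \<inter> {min t s..max t s} = {} then {} else \<alpha> ` {min t s..max t s})"
        "hrel (switch_path A \<alpha> \<beta> t +++ e) (switch_path A \<alpha> \<beta> s)"
        using switch_path_step_sym[OF t(1) s(1)] by blast
      have near: "x \<in> {0..1} \<and> dist x t < d \<and> dist x t < d'" if "x \<in> {min t s..max t s}" for x
        using that s t by (auto simp: dist_real_def min_def max_def split: if_splits)
      have "\<beta> ` {min t s..max t s} \<subseteq> U" using near d by blast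
      moreover have "\<alpha> ` {min t s..max t s} \<subseteq> U" if "A \<inter> {min t s..max t s} \<noteq> {}"
        using d'(2)[of s] s that by simp
      ultimately have "path_image e \<subseteq> U"
        using e(5) by (cases "A \<inter> {min t s..max t s} = {}") (simp_all, blast+)
      then have "cls (switch_path A \<alpha> \<beta> t +++ e) \<in> B"
        unfolding B(1) using e t(2) B switch_path_P[OF t(1)] by (intro basic_nbhd_join) auto
      moreover have "cls (switch_path A \<alpha> \<beta> t +++ e) = cls (switch_path A \<alpha> \<beta> s)"
        using e(6) by (subst cls_eq_iff) (auto simp: hrel_iff)
      ultimately show ?thesis by simp
    qed
    then show ?thesis using d(1) d'(1) by (intro exI[of _ "min d d'"]) auto
  qed
  then have "openin (top_of_set {0..1}) {t \<in> {0..1}. ?g t \<in> B}"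
    by (auto simp: openin_euclidean_subtopology_iff)
  moreover have "?g -` B \<inter> topspace (top_of_set {0..1}) = {t \<in> {0..1}. ?g t \<in> B}"
    by auto
  ultimately show "openin (top_of_set {0..1}) (?g -` B \<inter> topspace (top_of_set {0..1}))"
    by simp
next
  show "(\<lambda>t. cls (switch_path A \<alpha> \<beta> t)) ` topspace (top_of_set {0..1})
    \<subseteq> \<Union> {basic_nbhd X x0 H \<alpha> U |\<alpha> U. \<alpha> \<in> P \<and> openin (top_of_set X) U \<and> pathfinish \<alpha> \<in> U}"
    using topspace_path_cover[of X x0 H, unfolded path_cover_def topology_generated_by_topspace]
      switch_path_P(1)
    unfolding H_class_def by (auto intro: quotientI)
qed

end

lemma transfinite_products_if_unique_path_lifting:
  assumes "unique_path_lifting (path_cover X x0 H) endpoint_proj"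
  shows "well_defined_transfinite_products X x0 H"
  unfolding well_defined_transfinite_products_def
proof (intro allI impI, elim conjE)
  fix A \<alpha> \<beta>
  assume A: "closed A" "A \<subseteq> {0..1}" "{0, 1} \<subseteq> A" and P: "\<alpha> \<in> P" "\<beta> \<in> P"
    and agree: "\<forall>t\<in>A. \<alpha> t = \<beta> t"
    and gaps: "\<forall>a b. {a<..<b} \<in> components ({0..1} - A) \<longrightarrow>
           path_class X
             (restrict_path 0 b \<alpha> +++ reversepath (restrict_path a b \<beta>)
               +++ reversepath (restrict_path 0 a \<alpha>)) \<in> H"
  have A': "0 \<in> A" "1 \<in> A" using A by auto
  have g1: "hrel (restrict_path 0 b \<alpha>) (restrict_path 0 a \<alpha> +++ restrict_path a b \<beta>)"
    if "{a<..<b} \<in> components ({0..1} - A)" "a \<in> A" "b \<in> A" "a < b" for a b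
  proof -
    have I: "a \<in> {0..1}" "b \<in> {0..1}" using that A by auto
    have "reversepath (restrict_path 0 a \<alpha> +++ restrict_path a b \<beta>)
        = reversepath (restrict_path a b \<beta>) +++ reversepath (restrict_path 0 a \<alpha>)"
      using that agree by (intro reversepath_joinpaths) auto
    then have "quot (restrict_path 0 b \<alpha>) (restrict_path 0 a \<alpha> +++ restrict_path a b \<beta>) \<in> H"
      using gaps that by (simp add: quot_def)
    moreover have "restrict_path 0 a \<alpha> +++ restrict_path a b \<beta> \<in> P"
      using I P agree that
      by (intro P_join P_restrict path_restrict_path path_image_restrict_path_subset) (auto simp: P_iff)
    ultimately show ?thesis
      using I P agree that by (auto simp: hrel_iff intro: P_restrict)
  qed
  \<comment> \<open>With \<beta> in the role of \<alpha> the same construction gives the standard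
    lift up to homotopy, so a single continuity lemma serves both lifts.\<close>
  have g2: "hrel (restrict_path 0 b \<beta>) (restrict_path 0 a \<beta> +++ restrict_path a b \<beta>)"
    if "{a<..<b} \<in> components ({0..1} - A)" "a \<in> A" "b \<in> A" "a < b" for a b
    using that A P
    by (intro hrel_sym[OF hrel_homotopic] restrict_path_join_homotopic P_join P_restrict
         path_restrict_path path_image_restrict_path_subset) (auto simp: P_iff)
  note ctx1 = A(1,2) A' P agree[rule_format] g1
  note ctx2 = A(1,2) A' P(2) P(2) refl g2
  let ?f = "\<lambda>t. cls (switch_path A \<alpha> \<beta> t)" and ?g = "\<lambda>t. cls (switch_path A \<beta> \<beta> t)"
  have p1: "pathin (path_cover X x0 H) ?f" by (rule switch_path_continuous[OF ctx1])
  have p2: "pathin (path_cover X x0 H) ?g" by (rule switch_path_continuous[OF ctx2])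
  have s1: "switch_path A \<alpha> \<beta> t \<in> P \<and> pathfinish (switch_path A \<alpha> \<beta> t) = \<beta> t" if "t \<in> {0..1}" for t
    using switch_path_P[OF ctx1 that] by blast
  have s2: "switch_path A \<beta> \<beta> t \<in> P \<and> pathfinish (switch_path A \<beta> \<beta> t) = \<beta> t" if "t \<in> {0..1}" for t
    using switch_path_P[OF ctx2 that] by blast
  \<comment> \<open>At times in A the second factor is constant; at 0 and 1 this yields the common
    start and the final comparison.\<close>
  have at: "switch_path A f \<beta> t = restrict_path 0 t f +++ (\<lambda>_. \<beta> t)" if "t \<in> A" for f t
    using that A by (auto simp: switch_path_def last_in_self restrict_path_refl)
  have "\<alpha> 0 = \<beta> 0" using agree A' by auto
  then have "?f 0 = ?g 0" using A' by (simp add: at restrict_path_refl)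
  moreover have "endpoint_proj (?f t) = endpoint_proj (?g t)" if "t \<in> {0..1}" for t
    using s1[OF that] s2[OF that] base_in subgroup_H by (simp add: endpoint_proj_H_class)
  ultimately have "?f 1 = ?g 1"
    using assms p1 p2 unfolding unique_path_lifting_def by (meson atLeastAtMost_iff order_refl zero_le_one)
  moreover have "cls (f +++ (\<lambda>_. \<beta> 1)) = cls f" if "f \<in> P" "f 1 = \<beta> 1" for f
    using that by (intro H_class_cong right_const_homotopic) (auto simp: P_iff pathfinish_def)
  ultimately have "cls \<alpha> = cls \<beta>"
    using A' agree P by (simp add: at)
  then have "hrel \<alpha> \<beta>" using P cls_eq_iff by blast
  then show "path_class X (\<alpha> +++ reversepath \<beta>) \<in> H"
    by (simp add: hrel_iff quot_def)
qed

end

subsection \<open>Infinite concatenations and Cantor subdivision\<close>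

text \<open>Homotopy n runs during the time interval [n, n+1], and the half-line of times is
  compressed to [0,1). The family is continuous up to the final time because it is a uniform limit
  of the homotopies stopped at time n. Continuity of \<open>g\<close> is part of the conclusion;
  this is how \<open>transfinite_path\<close> turns out to be a path.\<close>

lemma homotopic_paths_infinite_concatenation:
  fixes X :: "'a::topological_space set" and h :: "nat \<Rightarrow> real \<Rightarrow> real \<Rightarrow> 'a"
  assumes metric: "Metric_space X d" and mtop: "Metric_space.mtopology X d = top_of_set X"
    and cont: "\<And>n. continuous_on ({0..1} \<times> {0..1}) (\<lambda>z. h n (fst z) (snd z))"
    and im: "\<And>n u t. u \<in> {0..1} \<Longrightarrow> t \<in> {0..1} \<Longrightarrow> h n u t \<in> X"
    and glue: "\<And>n t. t \<in> {0..1} \<Longrightarrow> h n 1 t = h (Suc n) 0 t"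
    and ends: "\<And>n u. u \<in> {0..1} \<Longrightarrow> h n u 0 = g 0" "\<And>n u. u \<in> {0..1} \<Longrightarrow> h n u 1 = g 1"
    and gX: "\<And>t. t \<in> {0..1} \<Longrightarrow> g t \<in> X"
    and lim: "\<And>\<epsilon>. \<epsilon> > 0 \<Longrightarrow> \<exists>N. \<forall>n\<ge>N. \<forall>u\<in>{0..1}. \<forall>t\<in>{0..1}. d (h n u t) (g t) < \<epsilon>"
  shows "homotopic_paths X (h 0 0) g"
proof -
  interpret Metric_space X d by (rule metric)
  define H' where "H' s t = h (nat \<lfloor>s\<rfloor>) (frac s) t" for s t :: real
  have H'_im: "H' s t \<in> X" if "0 \<le> s" "t \<in> {0..1}" for s t
    unfolding H'_def using that by (intro im) (auto simp: less_imp_le[OF frac_lt_1])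
  have H'_cont: "continuous_on ({0..real N} \<times> {0..1}) (\<lambda>z. H' (fst z) (snd z))" for N
  proof (induction N)
    case 0
    have "continuous_on ({0..real 0} \<times> {0..1}) (\<lambda>z. h 0 (fst z) (snd z))"
      by (rule continuous_on_subset[OF cont[of 0]]) auto
    then show ?case
      by (rule continuous_on_eq) (auto simp: H'_def)
  next
    case (Suc N)
    have "continuous_on ({real N..real (Suc N)} \<times> {0..1}) (\<lambda>z. (\<lambda>z. h N (fst z) (snd z)) (fst z - real N, snd z))"
      by (rule continuous_on_compose2[OF cont[of N]]) (auto intro!: continuous_intros)
    then have "continuous_on ({real N..real (Suc N)} \<times> {0..1}) (\<lambda>z. H' (fst z) (snd z))"
    proof (rule continuous_on_eq)
      fix z assume z: "z \<in> {real N..real (Suc N)} \<times> {0..1::real}"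
      show "h N (fst (fst z - real N, snd z)) (snd (fst z - real N, snd z)) = H' (fst z) (snd z)"
      proof (cases "fst z = real (Suc N)")
        \<comment> \<open>At the right end the floor has already moved on to homotopy N + 1, and
          \<open>glue\<close> matches the two.\<close>
        case True
        have "H' (fst z) (snd z) = h (Suc N) 0 (snd z)"
          unfolding H'_def True by (simp del: of_nat_Suc add: frac_def)
        then show ?thesis using glue[of "snd z" N] z True by auto
      next
        case False
        then have fl: "\<lfloor>fst z\<rfloor> = int N" using z by (auto simp: floor_eq_iff)
        show ?thesis unfolding H'_def fl by (simp add: frac_def fl)
      qed
    qed
    then have "continuous_on ({0..real N} \<times> {0..1} \<union> {real N..real (Suc N)} \<times> {0..1}) (\<lambda>z. H' (fst z) (snd z))"
      using Suc by (intro continuous_on_closed_Un) (auto intro!: closed_Times)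
    moreover have "{0..real N} \<times> {0..1::real} \<union> {real N..real (Suc N)} \<times> {0..1} = {0..real (Suc N)} \<times> {0..1}"
      by auto
    ultimately show ?case by simp
  qed
  \<comment> \<open>The map 1/(1-u) - 1 takes [0,1) onto the half-line of times; the lower bound
    1/(n+1) on 1-u stops the clock at time n and keeps the denominator positive.\<close>
  define S where "S n u = 1 / max (1 - u) (1 / (real n + 1)) - 1" for n :: nat and u :: real
  have S_range: "0 \<le> S n u" "S n u \<le> real n" if "u \<in> {0..1}" for n u
  proof -
    have pos: "0 < max (1 - u) (1 / (real n + 1))" by (simp add: less_max_iff_disj)
    have "max (1 - u) (1 / (real n + 1)) \<le> 1" using that by auto
    then show "0 \<le> S n u" using pos by (simp add: S_def)
    have "1 / max (1 - u) (1 / (real n + 1)) \<le> 1 / (1 / (real n + 1))"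
      by (rule divide_left_mono) (use pos in auto)
    then show "S n u \<le> real n" by (simp add: S_def)
  qed
  define I where "I = {0..1::real} \<times> {0..1::real}"
  define Hn where "Hn n z = H' (S n (fst z)) (snd z)" for n z
  define HH where "HH z = (if fst z < 1 then H' (1 / (1 - fst z) - 1) (snd z) else g (snd z))" for z
  have Hn_cont: "continuous_on I (Hn n)" for n
  proof -
    have "continuous_on I (\<lambda>z. (S n (fst z), snd z))"
      unfolding S_def by (intro continuous_intros) (auto simp: less_max_iff_disj max_def)
    then have "continuous_on I (\<lambda>z. (\<lambda>z. H' (fst z) (snd z)) (S n (fst z), snd z))"
      by (rule continuous_on_compose2[OF H'_cont[of n]]) (use S_range in \<open>auto simp: I_def\<close>)
    then show ?thesis by (simp add: Hn_def[abs_def])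
  qed
  have Hn_im: "Hn n z \<in> X" if "z \<in> I" for n z
    using that S_range[of "fst z" n] by (auto simp: Hn_def I_def intro!: H'_im)
  have HH_im: "HH z \<in> X" if "z \<in> I" for z
    using that by (auto simp: HH_def I_def divide_simps intro!: H'_im gX)
  \<comment> \<open>Before time n the stopped and the full homotopy coincide; afterwards both are
    within \<epsilon>/2 of \<open>g\<close>.\<close>
  have close: "\<forall>\<^sub>F n in sequentially. \<forall>z\<in>topspace (top_of_set I). d (Hn n z) (HH z) < \<epsilon>" if eps: "\<epsilon> > 0" for \<epsilon>
  proof -
    obtain N where N: "\<And>n u t. n \<ge> N \<Longrightarrow> u \<in> {0..1} \<Longrightarrow> t \<in> {0..1} \<Longrightarrow> d (h n u t) (g t) < \<epsilon> / 2"
      using lim[OF half_gt_zero[OF eps]] by metis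
    have far: "d (H' s t) (g t) < \<epsilon> / 2" if "real N \<le> s" "t \<in> {0..1}" for s t
      unfolding H'_def
    proof (rule N)
      show "N \<le> nat \<lfloor>s\<rfloor>" using that by (simp add: le_nat_floor)
      show "frac s \<in> {0..1}" by (auto simp: less_imp_le[OF frac_lt_1])
    qed (use that in auto)
    have "d (Hn n z) (HH z) < \<epsilon>" if n: "n \<ge> N" and z: "z \<in> I" for n z
    proof -
      obtain u t where ut: "z = (u, t)" "u \<in> {0..1}" "t \<in> {0..1}" using z by (auto simp: I_def)
      show ?thesis
      proof (cases "1 / (real n + 1) \<le> 1 - u")
        case True
        then have "u < 1" by (smt (verit) divide_pos_pos of_nat_0_le_iff)
        then have "Hn n z = HH z" using True ut by (simp add: Hn_def HH_def S_def max_def)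
        then show ?thesis using \<open>\<epsilon> > 0\<close> HH_im[OF z] by simp
      next
        case False
        then have "S n u = real n" by (simp add: S_def max_def)
        then have 1: "d (Hn n z) (g t) < \<epsilon> / 2" using far[of "real n" t] n ut by (simp add: Hn_def)
        have 2: "d (HH z) (g t) < \<epsilon> / 2"
        proof (cases "u < 1")
          case True
          have "1 / (1 / (real n + 1)) \<le> 1 / (1 - u)"
            using False True by (intro divide_left_mono) auto
          then have "real N \<le> 1 / (1 - u) - 1" using n by simp
          then show ?thesis using far ut True by (simp add: HH_def)
        next
          case False
          then show ?thesis using ut gX \<open>\<epsilon> > 0\<close> by (simp add: HH_def)
        qed
        have "d (Hn n z) (HH z) \<le> d (Hn n z) (g t) + d (HH z) (g t)"
          using triangle[of "Hn n z" "g t" "HH z"] Hn_im[OF z] HH_im[OF z] gX ut by (simp add: commute)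
        then show ?thesis using 1 2 by simp
      qed
    qed
    then show ?thesis unfolding eventually_sequentially topspace_euclidean_subtopology by blast
  qed
  have "continuous_map (top_of_set I) mtopology HH"
  proof (rule continuous_map_uniform_limit_alt)
    show "\<forall>\<^sub>F n in sequentially. continuous_map (top_of_set I) mtopology (Hn n)"
      using Hn_cont Hn_im by (intro always_eventually) (auto simp: mtop)
    show "HH \<in> topspace (top_of_set I) \<rightarrow> X" using HH_im by auto
  qed (use close in auto)
  then have HHc: "continuous_on I HH" by (simp add: mtop)
  have g_ends: "H' s 0 = g 0" "H' s 1 = g 1" if "0 \<le> s" for s
    using ends[of "frac s" "nat \<lfloor>s\<rfloor>"] unfolding H'_def by (auto simp: less_imp_le[OF frac_lt_1])
  show ?thesis
    unfolding homotopic_paths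
  proof (intro exI[of _ HH] conjI ballI)
    show "continuous_on ({0..1} \<times> {0..1}) HH" using HHc by (simp add: I_def)
    show "HH \<in> {0..1} \<times> {0..1} \<rightarrow> X" using HH_im by (auto simp: I_def)
    show "HH (0, x) = h 0 0 x" for x by (simp add: HH_def H'_def)
    show "HH (1, x) = g x" for x by (simp add: HH_def)
    fix t :: real assume t: "t \<in> {0..1}"
    show "pathstart (HH \<circ> Pair t) = pathstart (h 0 0)"
      using t ends(1)[of 0 0] g_ends(1)[of "1 / (1 - t) - 1"] by (auto simp: pathstart_def HH_def divide_simps)
    show "pathfinish (HH \<circ> Pair t) = pathfinish (h 0 0)"
      using t ends(2)[of 0 0] g_ends(2)[of "1 / (1 - t) - 1"] by (auto simp: pathfinish_def HH_def divide_simps)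
  qed
qed

section \<open>Iterated midpoint subdivision of a family of paths\<close>

fun refine ::
  "(real \<Rightarrow> real \<Rightarrow> real \<Rightarrow> 'b::topological_space) \<Rightarrow> (real \<Rightarrow> real \<Rightarrow> real \<Rightarrow> 'b) \<Rightarrow> nat \<Rightarrow> real \<Rightarrow> real \<Rightarrow> real \<Rightarrow> 'b"
where
  "refine T r 0 a b = r a b"
| "refine T r (Suc n) a b = refine T r n a ((a + b) / 2) +++ (T a b +++ refine T r n ((a + b) / 2) b)"

definition compat ::
  "(real \<Rightarrow> 'b::topological_space) \<Rightarrow> (real \<Rightarrow> real \<Rightarrow> real \<Rightarrow> 'b) \<Rightarrow> (real \<Rightarrow> real \<Rightarrow> real \<Rightarrow> 'b) \<Rightarrow> bool" where
  "compat \<gamma> T r \<longleftrightarrow> (\<forall>a b. 0 \<le> a \<and> a < b \<and> b \<le> 1 \<longrightarrow>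
     pathstart (r a b) = \<gamma> a \<and> pathfinish (r a b) = \<gamma> b \<and>
     pathstart (T a b) = \<gamma> ((a + b) / 2) \<and> pathfinish (T a b) = \<gamma> ((a + b) / 2))"

lemma compatD:
  assumes "compat \<gamma> T r" "0 \<le> a" "a < b" "b \<le> 1"
  shows "pathstart (r a b) = \<gamma> a" "pathfinish (r a b) = \<gamma> b"
     "pathstart (T a b) = \<gamma> ((a + b) / 2)" "pathfinish (T a b) = \<gamma> ((a + b) / 2)"
  using assms by (auto simp: compat_def)

lemma refine_ends:
  assumes "compat \<gamma> T r" "0 \<le> a" "a < b" "b \<le> 1"
  shows "pathstart (refine T r n a b) = \<gamma> a" "pathfinish (refine T r n a b) = \<gamma> b"
  using assms(2-) by (induction n arbitrary: a b) (auto simp: compatD[OF assms(1)])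

text \<open>The three ranges overlap: \<open>+++\<close> takes the left branch at 1/2 and 3/4, and
  \<open>compat\<close> makes the neighbouring branch give the same value, namely \<gamma> at the
  midpoint.\<close>

lemma refine_Suc_eval:
  assumes "compat \<gamma> T r" "0 \<le> a" "a < b" "b \<le> 1"
  shows "t \<le> 1/2 \<Longrightarrow> refine T r (Suc n) a b t = refine T r n a ((a + b) / 2) (2 * t)"
    "1/2 \<le> t \<Longrightarrow> t \<le> 3/4 \<Longrightarrow> refine T r (Suc n) a b t = T a b (4 * t - 2)"
    "3/4 \<le> t \<Longrightarrow> refine T r (Suc n) a b t = refine T r n ((a + b) / 2) b (4 * t - 3)"
proof -
  let ?m = "(a + b) / 2"
  have e: "refine T r n a ?m 1 = \<gamma> ?m" "refine T r n ?m b 0 = \<gamma> ?m" "T a b 0 = \<gamma> ?m" "T a b 1 = \<gamma> ?m"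
    using refine_ends[OF assms(1), of a ?m n] refine_ends[OF assms(1), of ?m b n] assms
      compatD(3,4)[OF assms]
    by (auto simp: pathstart_def pathfinish_def)
  show "t \<le> 1/2 \<Longrightarrow> refine T r (Suc n) a b t = refine T r n a ?m (2 * t)"
    by (simp add: joinpaths_def)
  show "refine T r (Suc n) a b t = T a b (4 * t - 2)" if "1/2 \<le> t" "t \<le> 3/4"
    using that
  proof (cases "t = 1/2")
    case True
    show ?thesis unfolding True using e(1,3) by (simp add: joinpaths_def)
  qed (simp add: joinpaths_def)
  show "refine T r (Suc n) a b t = refine T r n ?m b (4 * t - 3)" if "3/4 \<le> t"
    using that
  proof (cases "t = 3/4")
    case True
    show ?thesis unfolding True using e(2,4) by (simp add: joinpaths_def)
  qed (simp add: joinpaths_def)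
qed

lemma refine_cong:
  assumes "\<And>a b t. 0 \<le> a \<Longrightarrow> a < b \<Longrightarrow> b \<le> 1 \<Longrightarrow> t \<in> {0..1} \<Longrightarrow> r a b t = r' a b t"
    and "0 \<le> a" "a < b" "b \<le> 1" "t \<in> {0..1}"
  shows "refine T r n a b t = refine T r' n a b t"
  using assms(2-) by (induction n arbitrary: a b t) (auto simp: joinpaths_def assms(1))

text \<open>\<open>refine\<close> recurses from the root, whereas the elementary homotopies act on
  the leaves. Subdividing every leaf once more is the same as one more stage, so consecutive
  homotopies fit together.\<close>

lemma refine_Suc_shift:
  "refine T r (Suc n) a b =
     refine T (\<lambda>a b. r a ((a + b) / 2) +++ (T a b +++ r ((a + b) / 2) b)) n a b"
  by (induction n arbitrary: a b) simp_all

text \<open>The breakpoints 1/2 and 3/4 are those of \<open>p +++ (q +++ r)\<close>, so that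
  \<open>refine\<close> unfolds to library path joins: \<open>alive n t\<close> means that \<open>t\<close> has not yet
  entered a middle part \<open>q\<close> after \<open>n\<close> subdivisions.\<close>

fun alive :: "nat \<Rightarrow> real \<Rightarrow> bool" where
  "alive 0 t = True"
| "alive (Suc n) t = (t \<le> 1/2 \<and> alive n (2 * t) \<or> 3/4 \<le> t \<and> alive n (4 * t - 3))"

text \<open>The Cantor set obtained by repeatedly removing the open part between 1/2 and 3/4; its
  two contractions are t/2 and (t+3)/4, with the unequal ratios 1/2 and 1/4.\<close>

definition cantor_set :: "real set" where
  "cantor_set = {t \<in> {0..1}. \<forall>n. alive n t}"

lemma alive_antimono: "alive n t \<Longrightarrow> k \<le> n \<Longrightarrow> alive k t"
proof (induction k arbitrary: n t)
  case (Suc k)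
  then obtain n' where "n = Suc n'" "k \<le> n'" by (cases n) auto
  then show ?case using Suc by auto
qed simp

lemma cantor_set_halve: "t \<in> cantor_set \<Longrightarrow> t / 2 \<in> cantor_set"
  unfolding cantor_set_def
proof safe
  fix n assume t: "t \<in> {0..1}" "\<forall>n. alive n t"
  show "alive n (t / 2)" using t by (cases n) auto
qed auto

lemma cantor_set_quarter: "t \<in> cantor_set \<Longrightarrow> (t + 3) / 4 \<in> cantor_set"
  unfolding cantor_set_def
proof safe
  fix n assume t: "t \<in> {0..1}" "\<forall>n. alive n t"
  have "4 * ((t + 3) / 4) - 3 = t" by (simp add: field_simps)
  then show "alive n ((t + 3) / 4)" using t by (cases n) auto
qed auto

lemma cantor_set_0: "0 \<in> cantor_set"
proof -
  have "alive n 0" for n by (induction n) auto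
  then show ?thesis by (simp add: cantor_set_def)
qed

lemma cantor_set_1: "1 \<in> cantor_set"
proof -
  have "alive n 1" for n by (induction n) auto
  then show ?thesis by (simp add: cantor_set_def)
qed

text \<open>The case where \<gamma> is the identity of [0,1]: affine leaves and constant loops at
  the midpoints. As \<open>refine\<close> is generic in its target, the evaluation lemmas for paths
  in X also govern this real sequence, whose limit is the Cantor function of
  \<open>cantor_set\<close>.\<close>

definition cantor_approx :: "nat \<Rightarrow> real \<Rightarrow> real" where
  "cantor_approx n t = refine (\<lambda>a b _. (a + b) / 2) (\<lambda>a b t. a + (b - a) * t) n 0 1 t"

lemma compat_id: "compat (\<lambda>x. x) (\<lambda>a b _. (a + b) / 2) (\<lambda>a b t. a + (b - a) * t)"
  by (auto simp: compat_def pathstart_def pathfinish_def)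

text \<open>The identity case commutes with affine maps, so every interval reduces to [0,1] and the
  recursion closes on \<open>cantor_approx\<close>.\<close>

lemma refine_id_affine:
  "refine (\<lambda>a b _. (a + b) / 2) (\<lambda>a b t. a + (b - a) * t) n a b t = a + (b - a) * cantor_approx n t"
proof (induction n arbitrary: a b t)
  case 0
  then show ?case by (simp add: cantor_approx_def)
next
  case (Suc n)
  have "cantor_approx (Suc n) t =
      ((\<lambda>t. cantor_approx n t / 2) +++ ((\<lambda>_. 1/2) +++ (\<lambda>t. 1/2 + cantor_approx n t / 2))) t"
    unfolding cantor_approx_def[of "Suc n"] refine.simps joinpaths_def Suc by simp
  then show ?case
    unfolding refine.simps joinpaths_def Suc by (auto simp: field_simps)
qed

lemma cantor_approx_Suc:
  "t \<le> 1/2 \<Longrightarrow> cantor_approx (Suc n) t = cantor_approx n (2 * t) / 2"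
  "1/2 \<le> t \<Longrightarrow> t \<le> 3/4 \<Longrightarrow> cantor_approx (Suc n) t = 1/2"
  "3/4 \<le> t \<Longrightarrow> cantor_approx (Suc n) t = 1/2 + cantor_approx n (4 * t - 3) / 2"
  unfolding cantor_approx_def[of "Suc n"]
  using refine_Suc_eval[OF compat_id, of 0 1 t n] by (simp_all add: refine_id_affine)

lemma cantor_approx_0 [simp]: "cantor_approx 0 t = t"
  by (simp add: cantor_approx_def)

lemma cantor_approx_range: "t \<in> {0..1} \<Longrightarrow> cantor_approx n t \<in> {0..1}"
proof (induction n arbitrary: t)
  case (Suc n)
  consider "t \<le> 1/2" | "1/2 \<le> t" "t \<le> 3/4" | "3/4 \<le> t" by linarith
  then show ?case
    using Suc.IH[of "2 * t"] Suc.IH[of "4 * t - 3"] Suc.prems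
    by cases (auto simp: cantor_approx_Suc)
qed simp

lemma cantor_approx_ends [simp]: "cantor_approx n 0 = 0" "cantor_approx n 1 = 1"
  by (induction n) (auto simp: cantor_approx_Suc)

lemma cantor_approx_continuous: "continuous_on {0..1} (cantor_approx n)"
proof -
  have "path (refine (\<lambda>a b _. (a + b) / 2) (\<lambda>a b t. a + (b - a) * t) n a b)"
    if "0 \<le> a" "a < b" "b \<le> 1" for a b :: real
    using that
  proof (induction n arbitrary: a b)
    case 0
    then show ?case by (auto simp: path_def intro!: continuous_intros)
  next
    case (Suc n)
    then show ?case using refine_ends[OF compat_id] by (auto intro!: path_join_imp)
  qed
  from this[of 0 1] show ?thesis by (simp add: path_def cantor_approx_def[abs_def])
qed

text \<open>On the two outer pieces the recursion halves the difference of consecutive stages; on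
  the middle piece all stages from the first on equal 1/2.\<close>

lemma cantor_approx_step:
  "t \<in> {0..1} \<Longrightarrow> \<bar>cantor_approx (Suc n) t - cantor_approx n t\<bar> \<le> (1/2) ^ n"
proof (induction n arbitrary: t)
  case 0
  show ?case using cantor_approx_range[OF 0, of "Suc 0"] 0 by auto
next
  case (Suc n)
  consider "t \<le> 1/2" | "1/2 \<le> t" "t \<le> 3/4" | "3/4 \<le> t" by linarith
  then show ?case
  proof cases
    case 1
    then show ?thesis
      using Suc.IH[of "2 * t"] Suc.prems
      unfolding cantor_approx_Suc(1)[OF 1] by (auto simp flip: diff_divide_distrib)
  next
    case 2
    then show ?thesis by (simp add: cantor_approx_Suc)
  next
    case 3
    then show ?thesis
      using Suc.IH[of "4 * t - 3"] Suc.prems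
      unfolding cantor_approx_Suc(3)[OF 3] by (auto simp flip: diff_divide_distrib)
  qed
qed

definition cantor_fun :: "real \<Rightarrow> real" where
  "cantor_fun t = lim (\<lambda>n. cantor_approx n t)"

lemma cantor_approx_uniform_limit:
  "uniform_limit {0..1} cantor_approx cantor_fun sequentially"
proof -
  \<comment> \<open>The stages are written as telescoping sums, to which the M-test with the
    geometric bound applies.\<close>
  have "uniformly_convergent_on {0..1} (\<lambda>n t. \<Sum>i<n. cantor_approx (Suc i) t - cantor_approx i t)"
    by (rule Weierstrass_m_test'[of _ _ "\<lambda>n. (1/2) ^ n"])
      (auto intro!: summable_geometric cantor_approx_step)
  moreover have "(\<Sum>i<n. cantor_approx (Suc i) t - cantor_approx i t) = cantor_approx n t - t" for n t
    using sum_lessThan_telescope[of "\<lambda>i. cantor_approx i t" n] by simp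
  ultimately have "uniformly_convergent_on {0..1} (\<lambda>n t. cantor_approx n t - t)"
    by (simp only:)
  then obtain l where "uniform_limit {0..1} (\<lambda>n t. cantor_approx n t - t) l sequentially"
    by (auto simp: uniformly_convergent_on_def)
  moreover have "uniform_limit {0..1} (\<lambda>_ t. t) (\<lambda>t. t) sequentially"
    by (simp add: uniform_limit_iff)
  ultimately have "uniform_limit {0..1} (\<lambda>n t. (cantor_approx n t - t) + t) (\<lambda>t. l t + t) sequentially"
    by (rule uniform_limit_add)
  then have u: "uniform_limit {0..1} cantor_approx (\<lambda>t. l t + t) sequentially" by simp
  have "cantor_fun t = l t + t" if "t \<in> {0..1}" for t
    unfolding cantor_fun_def by (rule limI[OF tendsto_uniform_limitI[OF u that]])
  then show ?thesis
    using u by (subst uniform_limit_cong'[where g=cantor_approx and i="\<lambda>t. l t + t"]) auto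
qed

lemma cantor_approx_tendsto: "t \<in> {0..1} \<Longrightarrow> (\<lambda>n. cantor_approx n t) \<longlonglongrightarrow> cantor_fun t"
  by (rule tendsto_uniform_limitI[OF cantor_approx_uniform_limit])

lemma cantor_fun_continuous: "continuous_on {0..1} cantor_fun"
  by (rule uniform_limit_theorem[OF _ cantor_approx_uniform_limit])
    (auto intro: cantor_approx_continuous always_eventually)

lemma cantor_fun_ends [simp]: "cantor_fun 0 = 0" "cantor_fun 1 = 1"
  by (simp_all add: cantor_fun_def)

lemma cantor_fun_range: "t \<in> {0..1} \<Longrightarrow> cantor_fun t \<in> {0..1}"
  using Lim_in_closed_set[OF closed_real_atLeastAtMost[of 0 1] _ _ cantor_approx_tendsto[of t]]
    cantor_approx_range[of t] by (simp add: always_eventually)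

lemma cantor_fun_eqs:
  assumes "t \<in> {0..1}"
  shows "t \<le> 1/2 \<Longrightarrow> cantor_fun t = cantor_fun (2 * t) / 2"
    "1/2 \<le> t \<Longrightarrow> t \<le> 3/4 \<Longrightarrow> cantor_fun t = 1/2"
    "3/4 \<le> t \<Longrightarrow> cantor_fun t = 1/2 + cantor_fun (4 * t - 3) / 2"
proof -
  have lim: "(\<lambda>n. cantor_approx (Suc n) t) \<longlonglongrightarrow> cantor_fun t"
    using LIMSEQ_Suc[OF cantor_approx_tendsto[OF assms]] .
  show "cantor_fun t = cantor_fun (2 * t) / 2" if "t \<le> 1/2"
  proof (rule LIMSEQ_unique[OF lim])
    show "(\<lambda>n. cantor_approx (Suc n) t) \<longlonglongrightarrow> cantor_fun (2 * t) / 2"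
      using that assms by (simp add: cantor_approx_Suc) (intro tendsto_intros cantor_approx_tendsto, auto)
  qed
  show "cantor_fun t = 1/2" if "1/2 \<le> t" "t \<le> 3/4"
    using LIMSEQ_unique[OF lim, of "1/2"] that by (simp add: cantor_approx_Suc)
  show "cantor_fun t = 1/2 + cantor_fun (4 * t - 3) / 2" if "3/4 \<le> t"
  proof (rule LIMSEQ_unique[OF lim])
    show "(\<lambda>n. cantor_approx (Suc n) t) \<longlonglongrightarrow> 1/2 + cantor_fun (4 * t - 3) / 2"
      using that assms by (simp add: cantor_approx_Suc) (intro tendsto_intros cantor_approx_tendsto, auto)
  qed
qed

text \<open>By stage n such a t has entered one of the loops T, which neither further subdivision
  nor the choice of leaf paths affects. With the intermediate homotopies and
  \<open>short_path\<close> as the two families, all later stages agree at t.\<close>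

lemma refine_not_alive:
  assumes "compat \<gamma> T r" "compat \<gamma> T r'" "0 \<le> a" "a < b" "b \<le> 1" "t \<in> {0..1}" "\<not> alive n t" "n \<le> k"
  shows "refine T r k a b t = refine T r' n a b t"
  using assms(3-)
proof (induction n arbitrary: a b t k)
  case (Suc n)
  then obtain k' where k: "k = Suc k'" "n \<le> k'" by (cases k) auto
  note ev = refine_Suc_eval[OF assms(1) Suc.prems(1-3), of t k'] refine_Suc_eval[OF assms(2) Suc.prems(1-3), of t n]
  consider "t \<le> 1/2" | "1/2 < t" "t < 3/4" | "3/4 \<le> t" by linarith
  then show ?case
  proof cases
    case 1
    then show ?thesis using Suc ev k by auto
  next
    case 2
    then show ?thesis using ev k by simp
  next
    case 3
    then show ?thesis using Suc ev k by auto
  qed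
qed simp

text \<open>The descent that locates t depends on t alone, so both families end in the same dyadic
  interval with the same local parameter t'. The functional equations of \<open>cantor_fun\<close>
  follow the descent and keep its value in that interval.\<close>

lemma refine_alive:
  assumes "compat \<gamma> T r" "compat \<gamma> T r'" "0 \<le> a" "a < b" "b \<le> 1" "t \<in> {0..1}" "alive n t"
  shows "\<exists>a' b' t'. a \<le> a' \<and> a' < b' \<and> b' \<le> b \<and> b' - a' = (b - a) / 2 ^ n \<and> t' \<in> {0..1} \<and>
     a + (b - a) * cantor_fun t \<in> {a'..b'} \<and>
     (\<forall>k. refine T r (n + k) a b t = refine T r k a' b' t') \<and>
     (\<forall>k. refine T r' (n + k) a b t = refine T r' k a' b' t')"
  using assms(3-)
proof (induction n arbitrary: a b t)
  case 0
  have "0 \<le> (b - a) * cantor_fun t" "(b - a) * cantor_fun t \<le> (b - a) * 1"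
    by (intro mult_left_mono mult_nonneg_nonneg; use cantor_fun_range[of t] 0 in simp)+
  then have "a + (b - a) * cantor_fun t \<in> {a..b}" by simp
  then show ?case using 0 by (intro exI[of _ a] exI[of _ b] exI[of _ t]) auto
next
  case (Suc n)
  let ?m = "(a + b) / 2"
  have m: "a < ?m" "?m < b" using Suc.prems by auto
  note ev = refine_Suc_eval[OF assms(1) Suc.prems(1-3), of t] refine_Suc_eval[OF assms(2) Suc.prems(1-3), of t]
  consider "t \<le> 1/2" "alive n (2 * t)" | "3/4 \<le> t" "alive n (4 * t - 3)" using Suc.prems by auto
  then show ?case
  proof cases
    case 1
    obtain a' b' t' where *: "a \<le> a'" "a' < b'" "b' \<le> ?m" "b' - a' = (?m - a) / 2 ^ n" "t' \<in> {0..1}"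
      "a + (?m - a) * cantor_fun (2 * t) \<in> {a'..b'}"
      "\<forall>k. refine T r (n + k) a ?m (2 * t) = refine T r k a' b' t'"
      "\<forall>k. refine T r' (n + k) a ?m (2 * t) = refine T r' k a' b' t'"
      using Suc.IH[of a ?m "2 * t"] 1 Suc.prems m by auto
    have "a + (?m - a) * cantor_fun (2 * t) = a + (b - a) * cantor_fun t"
      using cantor_fun_eqs(1)[of t] 1 Suc.prems by (simp add: field_simps)
    moreover have "(?m - a) / 2 ^ n = (b - a) / 2 ^ Suc n" by (simp add: field_simps)
    ultimately show ?thesis
      using * m ev(1,4) 1
      by - (rule exI[of _ a'], rule exI[of _ b'], rule exI[of _ t'], simp)
  next
    case 2
    obtain a' b' t' where *: "?m \<le> a'" "a' < b'" "b' \<le> b" "b' - a' = (b - ?m) / 2 ^ n" "t' \<in> {0..1}"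
      "?m + (b - ?m) * cantor_fun (4 * t - 3) \<in> {a'..b'}"
      "\<forall>k. refine T r (n + k) ?m b (4 * t - 3) = refine T r k a' b' t'"
      "\<forall>k. refine T r' (n + k) ?m b (4 * t - 3) = refine T r' k a' b' t'"
      using Suc.IH[of ?m b "4 * t - 3"] 2 Suc.prems m by auto
    have c: "cantor_fun (4 * t - 3) = 2 * cantor_fun t - 1"
      using cantor_fun_eqs(3)[OF Suc.prems(4) 2(1)] by linarith
    have "?m + (b - ?m) * cantor_fun (4 * t - 3) = a + (b - a) * cantor_fun t"
      unfolding c by (simp add: field_simps)
    moreover have "(b - ?m) / 2 ^ n = (b - a) / 2 ^ Suc n" by (simp add: field_simps)
    ultimately show ?thesis
      using * m ev(3,6) 2
      by - (rule exI[of _ a'], rule exI[of _ b'], rule exI[of _ t'], simp)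
  qed
qed

text \<open>The gap is (1/2,3/4) transported by the contractions t/2 and (t+3)/4. On it the path
  runs through one loop T a' b', while the Cantor function rests at the midpoint of a' and b'. The
  ends p and q are in the Cantor set, so the statement about \<open>alive\<close> is restricted to
  the open gap, while the one about \<open>cantor_fun\<close> includes the ends.\<close>

lemma refine_gap:
  assumes "compat \<gamma> T r" "0 \<le> a" "a < b" "b \<le> 1" "t \<in> {0..1}" "\<not> alive n t"
  shows "\<exists>p q a' b'. 0 \<le> p \<and> p < t \<and> t < q \<and> q \<le> 1 \<and> p \<in> cantor_set \<and> q \<in> cantor_set \<and>
     a \<le> a' \<and> a' < b' \<and> b' \<le> b \<and>
     (\<forall>x. 0 < x \<and> x < 1 \<longrightarrow> \<not> alive n (p + (q - p) * x) \<and> refine T r n a b (p + (q - p) * x) = T a' b' x) \<and>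
     (\<forall>x\<in>{0..1}. a + (b - a) * cantor_fun (p + (q - p) * x) = (a' + b') / 2)"
  using assms(2-)
proof (induction n arbitrary: a b t)
  case (Suc n)
  let ?m = "(a + b) / 2"
  have m: "a < ?m" "?m < b" using Suc.prems by auto
  note ev = refine_Suc_eval[OF assms(1) Suc.prems(1-3)]
  consider "t \<le> 1/2" | "1/2 < t" "t < 3/4" | "3/4 \<le> t" by linarith
  then show ?case
  proof cases
    case 1
    then obtain p q a' b' where *: "0 \<le> p" "p < 2 * t" "2 * t < q" "q \<le> 1" "p \<in> cantor_set" "q \<in> cantor_set"
     "a \<le> a'" "a' < b'" "b' \<le> ?m"
     "\<And>x. 0 < x \<Longrightarrow> x < 1 \<Longrightarrow> \<not> alive n (p + (q - p) * x) \<and> refine T r n a ?m (p + (q - p) * x) = T a' b' x"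
     "\<And>x. x\<in>{0..1} \<Longrightarrow> a + (?m - a) * cantor_fun (p + (q - p) * x) = (a' + b') / 2"
      using Suc.IH[of a ?m "2 * t"] Suc.prems m by auto
    have r: "p + (q - p) * x \<in> {0..1}" if "x \<in> {0..1}" for x
      using affine_unit_interval[of p q x] * that by auto
    have e: "p / 2 + (q / 2 - p / 2) * x = (p + (q - p) * x) / 2" for x by (simp add: field_simps)
    have A: "\<not> alive (Suc n) (p / 2 + (q / 2 - p / 2) * x) \<and>
        refine T r (Suc n) a b (p / 2 + (q / 2 - p / 2) * x) = T a' b' x" if "0 < x" "x < 1" for x
    proof -
      define y where "y = p + (q - p) * x"
      have "2 * (y / 2) = y" "y \<in> {0..1}" using r[of x] that by (auto simp: y_def)
      then show ?thesis using *(10)[OF that] unfolding e y_def[symmetric] by (subst ev(1)) auto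
    qed
    have B: "a + (b - a) * cantor_fun (p / 2 + (q / 2 - p / 2) * x) = (a' + b') / 2" if "x \<in> {0..1}" for x
    proof -
      define y where "y = p + (q - p) * x"
      have "2 * (y / 2) = y" "y \<in> {0..1}" using r[OF that] by (auto simp: y_def)
      then show ?thesis using *(11)[OF that] unfolding e y_def[symmetric]
        by (subst cantor_fun_eqs(1)) (auto simp: field_simps)
    qed
    show ?thesis
      by (rule exI[of _ "p / 2"], rule exI[of _ "q / 2"], rule exI[of _ a'], rule exI[of _ b'])
        (use * A B m cantor_set_halve in auto)
  next
    case 2
    have e: "1/2 + (3/4 - 1/2) * x = (x + 2) / 4" for x :: real by (simp add: field_simps)
    have C: "1/2 \<in> cantor_set" "3/4 \<in> cantor_set"
      using cantor_set_halve[OF cantor_set_1] cantor_set_quarter[OF cantor_set_0] by auto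
    have A: "\<not> alive (Suc n) (1/2 + (3/4 - 1/2) * x) \<and>
        refine T r (Suc n) a b (1/2 + (3/4 - 1/2) * x) = T a b x" if "0 < x" "x < 1" for x
    proof -
      define y where "y = (x + 2) / 4"
      have y: "4 * y - 2 = x" "1/2 < y" "y < 3/4" using that by (auto simp: y_def field_simps)
      then show ?thesis unfolding e y_def[symmetric] using ev(2)[of y n] by simp
    qed
    have B: "a + (b - a) * cantor_fun (1/2 + (3/4 - 1/2) * x) = (a + b) / 2" if "x \<in> {0..1}" for x
      using that unfolding e by (subst cantor_fun_eqs(2)) (auto simp: field_simps)
    show ?thesis
      by (rule exI[of _ "1/2"], rule exI[of _ "3/4"], rule exI[of _ a], rule exI[of _ b])
        (use 2 Suc.prems A B C in simp)
  next
    case 3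
    then obtain p q a' b' where *: "0 \<le> p" "p < 4 * t - 3" "4 * t - 3 < q" "q \<le> 1" "p \<in> cantor_set" "q \<in> cantor_set"
     "?m \<le> a'" "a' < b'" "b' \<le> b"
     "\<And>x. 0 < x \<Longrightarrow> x < 1 \<Longrightarrow> \<not> alive n (p + (q - p) * x) \<and> refine T r n ?m b (p + (q - p) * x) = T a' b' x"
     "\<And>x. x\<in>{0..1} \<Longrightarrow> ?m + (b - ?m) * cantor_fun (p + (q - p) * x) = (a' + b') / 2"
      using Suc.IH[of ?m b "4 * t - 3"] Suc.prems m by auto
    have r: "p + (q - p) * x \<in> {0..1}" if "x \<in> {0..1}" for x
      using affine_unit_interval[of p q x] * that by auto
    have e: "(p + 3) / 4 + ((q + 3) / 4 - (p + 3) / 4) * x = ((p + (q - p) * x) + 3) / 4" for x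
      by (simp add: field_simps)
    have A: "\<not> alive (Suc n) ((p + 3) / 4 + ((q + 3) / 4 - (p + 3) / 4) * x) \<and>
        refine T r (Suc n) a b ((p + 3) / 4 + ((q + 3) / 4 - (p + 3) / 4) * x) = T a' b' x"
      if "0 < x" "x < 1" for x
    proof -
      define y where "y = p + (q - p) * x"
      have "4 * ((y + 3) / 4) - 3 = y" "y \<in> {0..1}"
        using r[of x] that by (auto simp: y_def field_simps)
      then show ?thesis using *(10)[OF that] unfolding e y_def[symmetric] by (subst ev(3)) auto
    qed
    have B: "a + (b - a) * cantor_fun ((p + 3) / 4 + ((q + 3) / 4 - (p + 3) / 4) * x) = (a' + b') / 2"
      if "x \<in> {0..1}" for x
    proof -
      define y where "y = p + (q - p) * x"
      have "4 * ((y + 3) / 4) - 3 = y" "y \<in> {0..1}"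
        using r[OF that] by (auto simp: y_def field_simps)
      then show ?thesis using *(11)[OF that] unfolding e y_def[symmetric]
        by (subst cantor_fun_eqs(3)) (auto simp: field_simps)
    qed
    show ?thesis
      by (rule exI[of _ "(p + 3) / 4"], rule exI[of _ "(q + 3) / 4"], rule exI[of _ a'], rule exI[of _ b'])
        (use * A B m cantor_set_quarter in auto)
  qed
qed simp

lemma closed_cantor_set: "closed cantor_set"
proof -
  have "\<exists>e>0. ball t e \<subseteq> - cantor_set" if t: "t \<notin> cantor_set" for t
  proof (cases "t \<in> {0..1}")
    case True
    then obtain n where "\<not> alive n t" using t by (auto simp: cantor_set_def)
    then obtain p q where pq: "p < t" "t < q"
      "\<And>x. 0 < x \<Longrightarrow> x < 1 \<Longrightarrow> \<not> alive n (p + (q - p) * x)"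
      \<comment> \<open>The identity instance is used only for its gap: the removed intervals do not
        depend on the paths being refined.\<close>
      using refine_gap[OF compat_id, of 0 1 t n] True by (metis zero_less_one order_refl)
    have "z \<notin> cantor_set" if z: "p < z" "z < q" for z
    proof -
      have "p + (q - p) * ((z - p) / (q - p)) = z" using z by simp
      moreover have "\<not> alive n (p + (q - p) * ((z - p) / (q - p)))"
        by (rule pq(3)) (use z in \<open>simp_all add: divide_simps\<close>)
      ultimately have "\<not> alive n z" by simp
      then show ?thesis unfolding cantor_set_def by blast
    qed
    moreover have "p < z \<and> z < q" if "z \<in> ball t (min (t - p) (q - t))" for z
      using that pq(1,2) by (auto simp: dist_real_def)
    moreover have "0 < min (t - p) (q - t)" using pq(1,2) by simp
    ultimately show ?thesis by blast
  next
    case False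
    then have "t \<in> - {0..1}" by simp
    moreover have "open (- {0..1::real})" by (intro open_Compl) auto
    ultimately obtain e where "e > 0" "ball t e \<subseteq> - {0..1}"
      by (meson open_contains_ball)
    then show ?thesis by (intro exI[of _ e]) (auto simp: cantor_set_def)
  qed
  then have "open (- cantor_set)" by (auto simp: open_contains_ball)
  then show ?thesis by (simp add: open_closed)
qed

text \<open>Each value lies on a leaf path or a loop of some subinterval; in this way smallness of
  the pieces passes to the whole refinement.\<close>

lemma refine_range:
  assumes "\<And>a b t. 0 \<le> a \<Longrightarrow> a < b \<Longrightarrow> b \<le> 1 \<Longrightarrow> t \<in> {0..1} \<Longrightarrow> r a b t \<in> S a b \<and> T a b t \<in> S a b"
    and "0 \<le> a" "a < b" "b \<le> 1" "t \<in> {0..1}"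
  shows "\<exists>a' b'. a \<le> a' \<and> a' < b' \<and> b' \<le> b \<and> refine T r n a b t \<in> S a' b'"
  using assms(2-)
proof (induction n arbitrary: a b t)
  case 0
  then show ?case using assms(1)[of a b t] by auto
next
  case (Suc n)
  let ?m = "(a + b) / 2"
  have m: "a < ?m" "?m < b" using Suc.prems by auto
  consider "t \<le> 1/2" | "1/2 < t" "t \<le> 3/4" | "3/4 < t" by linarith
  then show ?case
  proof cases
    case 1
    then have "refine T r (Suc n) a b t = refine T r n a ?m (2 * t)" by (simp add: joinpaths_def)
    then show ?thesis using Suc.IH[of a ?m "2 * t"] Suc.prems m 1 by force
  next
    case 2
    then have "refine T r (Suc n) a b t = T a b (2 * (2 * t - 1))" by (simp add: joinpaths_def)
    then show ?thesis using assms(1)[of a b "2 * (2 * t - 1)"] Suc.prems 2 by force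
  next
    case 3
    then have "refine T r (Suc n) a b t = refine T r n ?m b (2 * (2 * t - 1) - 1)"
      by (simp add: joinpaths_def)
    moreover have "\<exists>a' b'. ?m \<le> a' \<and> a' < b' \<and> b' \<le> b \<and>
        refine T r n ?m b (2 * (2 * t - 1) - 1) \<in> S a' b'"
      by (rule Suc.IH) (use Suc.prems m 3 in auto)
    then obtain a' b' where "?m \<le> a'" "a' < b'" "b' \<le> b"
        "refine T r n ?m b (2 * (2 * t - 1) - 1) \<in> S a' b'"
      by blast
    ultimately show ?thesis using m by (intro exI[of _ a'] exI[of _ b']) simp
  qed
qed

text \<open>The meeting points of the joined paths are values of \<gamma> and do not move with the
  homotopy time u, so the joins are jointly continuous in u and t.\<close>

lemma continuous_on_refine:
  fixes k :: "real \<Rightarrow> real \<Rightarrow> real \<Rightarrow> real \<Rightarrow> 'b::topological_space"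
  assumes "\<And>u. u \<in> {0..1} \<Longrightarrow> compat \<gamma> T (\<lambda>a b. k a b u)"
    and "\<And>a b. 0 \<le> a \<Longrightarrow> a < b \<Longrightarrow> b \<le> 1 \<Longrightarrow>
           continuous_on ({0..1} \<times> {0..1}) (\<lambda>z. k a b (fst z) (snd z))"
    and "\<And>a b. 0 \<le> a \<Longrightarrow> a < b \<Longrightarrow> b \<le> 1 \<Longrightarrow> path (T a b)"
    and "0 \<le> a" "a < b" "b \<le> 1"
  shows "continuous_on ({0..1} \<times> {0..1}) (\<lambda>z. refine T (\<lambda>a b. k a b (fst z)) n a b (snd z))"
  using assms(4-)
proof (induction n arbitrary: a b)
  case 0
  then show ?case using assms(2)[of a b] by simp
next
  case (Suc n)
  let ?m = "(a + b) / 2"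
  have m: "0 \<le> a" "a < ?m" "?m \<le> 1" "0 \<le> ?m" "?m < b" "b \<le> 1" using Suc.prems by auto
  have "continuous_on ({0..1} \<times> {0..1}) (\<lambda>z::real \<times> real. T a b (snd z))"
    by (rule continuous_on_compose2[OF assms(3)[unfolded path_def, of a b]])
      (use Suc.prems in \<open>auto intro!: continuous_intros\<close>)
  then have "continuous_on ({0..1} \<times> {0..1})
      (\<lambda>z. (T a b +++ refine T (\<lambda>a b. k a b (fst z)) n ?m b) (snd z))"
    using Suc.IH[of ?m b] m refine_ends(1)[OF assms(1) m(4-6)] compatD(4)[OF assms(1) Suc.prems]
    by (intro continuous_on_homotopic_join_lemma[where
         p="\<lambda>_. T a b" and q="\<lambda>u. refine T (\<lambda>a b. k a b u) n ?m b"]) auto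
  then show ?case
    unfolding refine.simps
    using Suc.IH[of a ?m] m refine_ends(2)[OF assms(1) m(1-3)] compatD(3)[OF assms(1) Suc.prems]
    by (intro continuous_on_homotopic_join_lemma[where
         p="\<lambda>u. refine T (\<lambda>a b. k a b u) n a ?m" and q="\<lambda>u. T a b +++ refine T (\<lambda>a b. k a b u) n ?m b"]) auto
qed

text \<open>Off the Cantor set the stages are eventually constant, so the first stage that reaches a
  loop already has the limit value. On the Cantor set the leaf paths are meant to shrink to the
  point of \<gamma> at the Cantor value.\<close>

definition refine_limit ::
  "(real \<Rightarrow> 'b::topological_space) \<Rightarrow> (real \<Rightarrow> real \<Rightarrow> real \<Rightarrow> 'b) \<Rightarrow> (real \<Rightarrow> real \<Rightarrow> real \<Rightarrow> 'b) \<Rightarrow> real \<Rightarrow> 'b"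
where
  "refine_limit \<gamma> T r t =
     (if \<exists>n. \<not> alive n t then refine T r (LEAST n. \<not> alive n t) 0 1 t else \<gamma> (cantor_fun t))"

lemma refine_limit_cantor_set: "t \<in> cantor_set \<Longrightarrow> refine_limit \<gamma> T r t = \<gamma> (cantor_fun t)"
  unfolding refine_limit_def cantor_set_def by simp

lemma refine_limit_not_alive:
  assumes "compat \<gamma> T r" "t \<in> {0..1}" "\<not> alive n t"
  shows "refine_limit \<gamma> T r t = refine T r n 0 1 t"
proof -
  define L where "L = (LEAST n. \<not> alive n t)"
  have ex: "\<exists>n. \<not> alive n t" using assms(3) by blast
  have L: "\<not> alive L t" "L \<le> n"
    unfolding L_def using assms(3) by (rule LeastI, rule Least_le)
  have "refine T r n 0 1 t = refine T r L 0 1 t"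
    by (rule refine_not_alive[OF assms(1,1) _ _ _ assms(2) L]) simp_all
  moreover have "refine_limit \<gamma> T r t = refine T r L 0 1 t"
    unfolding refine_limit_def L_def by (rule if_P[OF ex])
  ultimately show ?thesis by (rule trans[OF _ sym, rotated])
qed

subsection \<open>Representing a lift by short paths\<close>

context path_subgroup
begin

text \<open>These are the paths whose right action carries the class of \<phi> s to that of \<phi>
  t. They can be reversed and composed, so a loop assembled from them fixes the class at its base
  time.\<close>

definition lift_path :: "(real \<Rightarrow> real \<Rightarrow> 'a) \<Rightarrow> real \<Rightarrow> real \<Rightarrow> (real \<Rightarrow> 'a) \<Rightarrow> bool" where
  "lift_path \<phi> s t r \<longleftrightarrow> path r \<and> path_image r \<subseteq> X \<and> pathstart r = pathfinish (\<phi> s) \<and>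
     pathfinish r = pathfinish (\<phi> t) \<and> hrel (\<phi> s +++ r) (\<phi> t)"

lemma lift_path_exists:
  assumes "\<phi> s \<in> P" "\<phi> t \<in> P"
  shows "lift_path \<phi> s t (reversepath (\<phi> s) +++ \<phi> t)"
proof -
  have 1: "path (\<phi> s)" "path_image (\<phi> s) \<subseteq> X" "path (\<phi> t)" "path_image (\<phi> t) \<subseteq> X"
    "pathstart (\<phi> t) = pathstart (\<phi> s)"
    using assms by (auto simp: P_iff)
  have "hrel (\<phi> s +++ (reversepath (\<phi> s) +++ \<phi> t)) (\<phi> t)"
    using 1 assms by (intro hrel_homotopic join_cancel_left P_join) (simp_all add: subset_path_image_join)
  then show ?thesis using 1 by (simp add: lift_path_def subset_path_image_join)
qed

lemma lift_path_reverse: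
  assumes "lift_path \<phi> s t r" "\<phi> s \<in> P" "\<phi> t \<in> P"
  shows "lift_path \<phi> t s (reversepath r)"
proof -
  have r: "path r" "path_image r \<subseteq> X" "pathstart r = pathfinish (\<phi> s)"
     "pathfinish r = pathfinish (\<phi> t)" "hrel (\<phi> s +++ r) (\<phi> t)"
    using assms(1) by (simp_all add: lift_path_def)
  have "hrel (\<phi> t +++ reversepath r) ((\<phi> s +++ r) +++ reversepath r)"
    using r by (intro hrel_join hrel_sym[OF r(5)]) simp_all
  also have "hrel \<dots> (\<phi> s)"
    using r assms by (intro hrel_homotopic join_cancel_right P_join) (simp_all add: P_iff subset_path_image_join)
  finally show ?thesis using r by (simp add: lift_path_def)
qed

lemma lift_path_join:
  assumes "lift_path \<phi> s t q" "lift_path \<phi> t u r" "\<phi> s \<in> P"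
  shows "lift_path \<phi> s u (q +++ r)"
proof -
  have q: "path q" "path_image q \<subseteq> X" "pathstart q = pathfinish (\<phi> s)"
     "pathfinish q = pathfinish (\<phi> t)" "hrel (\<phi> s +++ q) (\<phi> t)"
    using assms(1) by (simp_all add: lift_path_def)
  have r: "path r" "path_image r \<subseteq> X" "pathstart r = pathfinish (\<phi> t)"
     "pathfinish r = pathfinish (\<phi> u)" "hrel (\<phi> t +++ r) (\<phi> u)"
    using assms(2) by (simp_all add: lift_path_def)
  have "hrel (\<phi> s +++ (q +++ r)) ((\<phi> s +++ q) +++ r)"
    using q r assms by (intro hrel_sym[OF hrel_assoc]) simp_all
  also have "hrel \<dots> (\<phi> t +++ r)" using q r by (intro hrel_join) simp_all
  also have "hrel \<dots> (\<phi> u)" by fact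
  finally show ?thesis using q r by (simp add: lift_path_def subset_path_image_join)
qed

end

text \<open>\<open>\<phi> t\<close> represents the point at time \<open>t\<close> of a path in the space of H-classes lying over \<open>\<gamma>\<close>;
  \<open>local_lift\<close> expresses the continuity of that path.\<close>

locale class_lift = path_subgroup X x0 H
  for X :: "'a::topological_space set" and x0 H +
  fixes \<phi> :: "real \<Rightarrow> real \<Rightarrow> 'a" and \<gamma> :: "real \<Rightarrow> 'a" and d :: "'a \<Rightarrow> 'a \<Rightarrow> real"
  assumes metric: "Metric_space X d" and mtop: "Metric_space.mtopology X d = top_of_set X"
    and normal: "H \<lhd> G"
    and products: "well_defined_transfinite_products X x0 H"
    and \<phi>: "\<And>t. t \<in> {0..1} \<Longrightarrow> \<phi> t \<in> P"
    and \<gamma>: "\<And>t. t \<in> {0..1} \<Longrightarrow> pathfinish (\<phi> t) = \<gamma> t"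
    and local_lift: "\<And>t U. t \<in> {0..1} \<Longrightarrow> openin (top_of_set X) U \<Longrightarrow> \<gamma> t \<in> U \<Longrightarrow>
      \<exists>\<delta>>0. \<forall>s\<in>{0..1}. dist s t < \<delta> \<longrightarrow> (\<exists>e. lift_path \<phi> t s e \<and> path_image e \<subseteq> U)"
begin

section \<open>Uniformly short representatives of increments\<close>

sublocale metric: Metric_space X d by (rule metric)

lemma \<gamma>_in: "t \<in> {0..1} \<Longrightarrow> \<gamma> t \<in> X"
  using \<phi>[of t] \<gamma>[of t] pathfinish_in_path_image[of "\<phi> t"] by (auto simp: P_iff)

lemma path_\<gamma>: "path \<gamma>" "path_image \<gamma> \<subseteq> X"
proof -
  show im: "path_image \<gamma> \<subseteq> X" using \<gamma>_in by (auto simp: path_image_def)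
  have "openin (top_of_set {0..1}) ({0..1} \<inter> \<gamma> -` U)" if U: "openin (top_of_set X) U" for U
    unfolding openin_euclidean_subtopology_iff
  proof (intro conjI ballI)
    fix t assume t: "t \<in> {0..1} \<inter> \<gamma> -` U"
    then obtain \<delta> where \<delta>: "\<delta> > 0"
      "\<And>s. s\<in>{0..1} \<Longrightarrow> dist s t < \<delta> \<Longrightarrow> \<exists>e. lift_path \<phi> t s e \<and> path_image e \<subseteq> U"
      using local_lift[of t U] U by blast
    have "\<gamma> s \<in> U" if s: "s \<in> {0..1}" "dist s t < \<delta>" for s
    proof -
      obtain e where "lift_path \<phi> t s e" "path_image e \<subseteq> U" using \<delta>(2)[OF s] by blast
      then show ?thesis
        using pathfinish_in_path_image[of e] \<gamma>[OF s(1)] by (auto simp: lift_path_def)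
    qed
    then show "\<exists>e>0. \<forall>s\<in>{0..1}. dist s t < e \<longrightarrow> s \<in> {0..1} \<inter> \<gamma> -` U"
      using \<delta>(1) by auto
  qed auto
  then show "path \<gamma>"
    unfolding path_def using im
    by (subst continuous_on_open_gen[of _ _ X]) (auto simp: path_image_def)
qed

text \<open>By compactness of [0,1] the local lifts have a Lebesgue number. Two nearby times are
  joined by going back to a common centre p and out again; radius \<epsilon>/2 around \<gamma> p
  becomes \<epsilon> around \<gamma> s by the triangle inequality.\<close>

lemma small_lift_path:
  assumes "\<epsilon> > 0"
  shows "\<exists>\<delta>>0. \<forall>s\<in>{0..1}. \<forall>t\<in>{0..1}. \<bar>s - t\<bar> < \<delta> \<longrightarrow>
    (\<exists>r. lift_path \<phi> s t r \<and> path_image r \<subseteq> metric.mball (\<gamma> s) \<epsilon>)"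
proof -
  define U where "U p = metric.mball (\<gamma> p) (\<epsilon> / 2)" for p
  have U: "openin (top_of_set X) (U p)" for p
    using metric.openin_mball[of "\<gamma> p" "\<epsilon> / 2"] by (simp add: U_def mtop)
  have "\<exists>\<delta>>0. \<forall>s\<in>{0..1}. dist s p < \<delta> \<longrightarrow> (\<exists>e. lift_path \<phi> p s e \<and> path_image e \<subseteq> U p)"
    if "p \<in> {0..1}" for p
    using that assms \<gamma>_in by (intro local_lift U) (auto simp: U_def)
  then obtain \<delta> where \<delta>: "\<And>p. p \<in> {0..1} \<Longrightarrow> \<delta> p > 0"
     "\<And>p s. p \<in> {0..1} \<Longrightarrow> s\<in>{0..1} \<Longrightarrow> dist s p < \<delta> p \<Longrightarrow> \<exists>e. lift_path \<phi> p s e \<and> path_image e \<subseteq> U p"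
    by metis
  have cov: "{0..1} \<subseteq> \<Union> ((\<lambda>p. ball p (\<delta> p)) ` {0..1})" using \<delta>(1) by force
  obtain \<eta> where \<eta>: "\<eta> > 0" "\<And>x. x \<in> {0..1} \<Longrightarrow> \<exists>B\<in>(\<lambda>p. ball p (\<delta> p)) ` {0..1}. ball x \<eta> \<subseteq> B"
    using Heine_Borel_lemma[of "{0..1::real}", OF _ cov] by auto
  have "\<exists>r. lift_path \<phi> s t r \<and> path_image r \<subseteq> metric.mball (\<gamma> s) \<epsilon>"
    if st: "s \<in> {0..1}" "t \<in> {0..1}" "\<bar>s - t\<bar> < \<eta>" for s t
  proof -
    obtain p where p: "p \<in> {0..1}" "ball s \<eta> \<subseteq> ball p (\<delta> p)" using \<eta>(2)[OF st(1)] by auto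
    have "s \<in> ball s \<eta>" "t \<in> ball s \<eta>" using \<eta>(1) st(3) by (auto simp: dist_real_def)
    then have "s \<in> ball p (\<delta> p)" "t \<in> ball p (\<delta> p)" using p(2) by blast+
    then have "dist s p < \<delta> p" "dist t p < \<delta> p" by (simp_all add: dist_commute)
    then obtain e e' where e: "lift_path \<phi> p s e" "path_image e \<subseteq> U p" "lift_path \<phi> p t e'" "path_image e' \<subseteq> U p"
      using \<delta>(2) p st by meson
    have "lift_path \<phi> s t (reversepath e +++ e')"
      using e p st \<phi> by (intro lift_path_join[OF lift_path_reverse]) auto
    moreover have sub: "path_image (reversepath e +++ e') \<subseteq> U p"
      using e by (intro subset_path_image_join) auto
    moreover have "\<gamma> s \<in> U p"
      using e \<gamma>[OF st(1)] pathfinish_in_path_image[of e] by (auto simp: lift_path_def)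
    moreover have "U p \<subseteq> metric.mball (\<gamma> s) \<epsilon>" if "\<gamma> s \<in> U p"
    proof
      fix x assume x: "x \<in> U p"
      have "d (\<gamma> s) x \<le> d (\<gamma> s) (\<gamma> p) + d (\<gamma> p) x"
        using x that by (intro metric.triangle) (auto simp: U_def)
      then show "x \<in> metric.mball (\<gamma> s) \<epsilon>" using x that by (auto simp: U_def metric.commute)
    qed
    ultimately show ?thesis by blast
  qed
  then show ?thesis using \<eta>(1) by blast
qed

text \<open>The infimum of the possible radii need not be attained; the slack \<open>\<bar>s - t\<bar>\<close> makes a choice
  possible and still tends to 0.\<close>

definition near_optimal :: "real \<Rightarrow> real \<Rightarrow> (real \<Rightarrow> 'a) \<Rightarrow> bool" where
  "near_optimal s t r \<longleftrightarrow> lift_path \<phi> s t r \<and>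
     (\<forall>\<rho> r'. lift_path \<phi> s t r' \<and> path_image r' \<subseteq> metric.mball (\<gamma> s) \<rho> \<longrightarrow>
        path_image r \<subseteq> metric.mball (\<gamma> s) (\<rho> + \<bar>s - t\<bar>))"

lemma near_optimal_exists:
  assumes "s \<in> {0..1}" "t \<in> {0..1}" "s \<noteq> t"
  shows "\<exists>r. near_optimal s t r"
proof -
  define R where "R = {\<rho>. \<exists>r. lift_path \<phi> s t r \<and> path_image r \<subseteq> metric.mball (\<gamma> s) \<rho>}"
  show ?thesis
  proof (cases "R = {}")
    \<comment> \<open>Without admissible radii the second clause of \<open>near_optimal\<close> is
      vacuous, and the detour through x0 will do.\<close>
    case True
    then have "near_optimal s t (reversepath (\<phi> s) +++ \<phi> t)"
      using lift_path_exists[of \<phi> s t] \<phi> assms unfolding near_optimal_def R_def by blast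
    then show ?thesis by blast
  next
    case False
    have bdd: "bdd_below R"
    proof (rule bdd_belowI[of _ 0])
      fix \<rho> assume "\<rho> \<in> R"
      then obtain r where "lift_path \<phi> s t r" "path_image r \<subseteq> metric.mball (\<gamma> s) \<rho>" by (auto simp: R_def)
      then have "pathstart r \<in> metric.mball (\<gamma> s) \<rho>" using pathstart_in_path_image by blast
      then have "0 \<le> d (\<gamma> s) (pathstart r)" "d (\<gamma> s) (pathstart r) < \<rho>" by auto
      then show "0 \<le> \<rho>" by linarith
    qed
    have "Inf R < Inf R + \<bar>s - t\<bar>" using assms by simp
    then obtain \<rho>0 where \<rho>0: "\<rho>0 \<in> R" "\<rho>0 < Inf R + \<bar>s - t\<bar>"
      using cInf_less_iff[OF False bdd] by blast
    then obtain r where r: "lift_path \<phi> s t r" "path_image r \<subseteq> metric.mball (\<gamma> s) \<rho>0"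
      by (auto simp: R_def)
    have "path_image r \<subseteq> metric.mball (\<gamma> s) (\<rho> + \<bar>s - t\<bar>)" if "\<rho> \<in> R" for \<rho>
    proof -
      have "\<rho>0 \<le> \<rho> + \<bar>s - t\<bar>" using \<rho>0(2) cInf_lower[OF that bdd] by linarith
      then show ?thesis using r(2) metric.mball_subset_concentric by blast
    qed
    then show ?thesis using r(1) unfolding near_optimal_def R_def by blast
  qed
qed

definition short_path :: "real \<Rightarrow> real \<Rightarrow> real \<Rightarrow> 'a" where
  "short_path s t = (SOME r. near_optimal s t r)"

lemma short_path:
  assumes "0 \<le> a" "a < b" "b \<le> 1"
  shows "near_optimal a b (short_path a b)" "lift_path \<phi> a b (short_path a b)"
proof -
  show "near_optimal a b (short_path a b)"
    unfolding short_path_def by (rule someI_ex[OF near_optimal_exists]) (use assms in auto)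
  then show "lift_path \<phi> a b (short_path a b)" by (simp add: near_optimal_def)
qed

text \<open>One choice of paths has to serve every \<epsilon>. Comparison with some path of radius
  \<epsilon>/2 costs at most the slack b - a, hence the bound
  \<open>min \<delta> (\<epsilon> / 2)\<close>.\<close>

lemma short_path_small:
  assumes "\<epsilon> > 0"
  shows "\<exists>\<delta>>0. \<forall>a b. 0 \<le> a \<and> a < b \<and> b \<le> 1 \<and> b - a < \<delta> \<longrightarrow> path_image (short_path a b) \<subseteq> metric.mball (\<gamma> a) \<epsilon>"
proof -
  obtain \<delta> where \<delta>: "\<delta> > 0" "\<And>s t. s\<in>{0..1} \<Longrightarrow> t\<in>{0..1} \<Longrightarrow> \<bar>s - t\<bar> < \<delta> \<Longrightarrow>
    \<exists>r. lift_path \<phi> s t r \<and> path_image r \<subseteq> metric.mball (\<gamma> s) (\<epsilon> / 2)"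
    using small_lift_path[of "\<epsilon> / 2"] assms by auto
  have "path_image (short_path a b) \<subseteq> metric.mball (\<gamma> a) \<epsilon>"
    if ab: "0 \<le> a" "a < b" "b \<le> 1" "b - a < min \<delta> (\<epsilon> / 2)" for a b
  proof -
    have "a \<in> {0..1}" "b \<in> {0..1}" "\<bar>a - b\<bar> < \<delta>" using ab by auto
    then obtain r where "lift_path \<phi> a b r" "path_image r \<subseteq> metric.mball (\<gamma> a) (\<epsilon> / 2)"
      using \<delta>(2) by blast
    then have "path_image (short_path a b) \<subseteq> metric.mball (\<gamma> a) (\<epsilon> / 2 + \<bar>a - b\<bar>)"
      using short_path(1)[OF ab(1-3)] unfolding near_optimal_def by blast
    also have "\<dots> \<subseteq> metric.mball (\<gamma> a) \<epsilon>"
      using ab by (intro metric.mball_subset_concentric) auto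
    finally show ?thesis .
  qed
  then show ?thesis using \<delta>(1) assms by (intro exI[of _ "min \<delta> (\<epsilon> / 2)"]) auto
qed

definition triangle_loop :: "real \<Rightarrow> real \<Rightarrow> real \<Rightarrow> 'a" where
  "triangle_loop a b = reversepath (short_path a ((a + b) / 2)) +++ (short_path a b +++ reversepath (short_path ((a + b) / 2) b))"

definition triangle_set :: "real \<Rightarrow> real \<Rightarrow> 'a set" where
  "triangle_set a b = path_image (short_path a b) \<union> path_image (short_path a ((a + b) / 2)) \<union> path_image (short_path ((a + b) / 2) b)"

lemma short_path_facts:
  assumes "0 \<le> a" "a < b" "b \<le> 1"
  shows "path (short_path a b)" "path_image (short_path a b) \<subseteq> X" "pathstart (short_path a b) = \<gamma> a" "pathfinish (short_path a b) = \<gamma> b"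
  using short_path(2)[OF assms] \<gamma>[of a] \<gamma>[of b] assms by (auto simp: lift_path_def)

lemma midpoint_facts:
  fixes a b :: real
  assumes "0 \<le> a" "a < b" "b \<le> 1"
  shows "a < (a + b) / 2" "(a + b) / 2 \<le> 1" "0 \<le> (a + b) / 2" "(a + b) / 2 < b"
  using assms by auto

lemma triangle_loop_lift:
  assumes "0 \<le> a" "a < b" "b \<le> 1"
  shows "lift_path \<phi> ((a + b) / 2) ((a + b) / 2) (triangle_loop a b)"
proof -
  let ?m = "(a + b) / 2"
  note m = midpoint_facts[OF assms]
  have P: "\<phi> a \<in> P" "\<phi> b \<in> P" "\<phi> ?m \<in> P" using assms m by (auto intro!: \<phi>)
  have "lift_path \<phi> ?m a (reversepath (short_path a ?m))"
    by (rule lift_path_reverse[OF short_path(2)[OF assms(1) m(1,2)] P(1,3)])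
  moreover have "lift_path \<phi> b ?m (reversepath (short_path ?m b))"
    by (rule lift_path_reverse[OF short_path(2)[OF m(3,4) assms(3)] P(3,2)])
  moreover have "lift_path \<phi> a b (short_path a b)" by (rule short_path(2)[OF assms])
  ultimately show ?thesis
    unfolding triangle_loop_def by (meson lift_path_join P)
qed

lemma triangle_loop_facts:
  assumes "0 \<le> a" "a < b" "b \<le> 1"
  shows "path (triangle_loop a b)" "path_image (triangle_loop a b) \<subseteq> X"
    "pathstart (triangle_loop a b) = \<gamma> ((a + b) / 2)" "pathfinish (triangle_loop a b) = \<gamma> ((a + b) / 2)"
  using triangle_loop_lift[OF assms] \<gamma>[of "(a + b) / 2"] midpoint_facts[OF assms] by (auto simp: lift_path_def)

lemma path_image_triangle_loop:
  assumes "0 \<le> a" "a < b" "b \<le> 1"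
  shows "path_image (triangle_loop a b) \<subseteq> triangle_set a b"
  unfolding triangle_loop_def triangle_set_def
  by (intro subset_path_image_join) (simp_all add: le_supI1 le_supI2)

lemma triangle_set_subset: "0 \<le> a \<Longrightarrow> a < b \<Longrightarrow> b \<le> 1 \<Longrightarrow> triangle_set a b \<subseteq> X"
  unfolding triangle_set_def using midpoint_facts[of a b] by (intro Un_least short_path_facts(2)) simp_all

lemma compat_short_path: "compat \<gamma> triangle_loop short_path"
  unfolding compat_def by (simp add: short_path_facts triangle_loop_facts)

text \<open>The outer factors of \<open>triangle_loop\<close> cancel against the paths next to it.
  Every cancellation retraces one of the three paths, so the homotopy stays in
  \<open>triangle_set\<close>; a homotopy merely in X would give no control in the limit.\<close>

lemma short_path_homotopic_refinement:
  assumes "0 \<le> a" "a < b" "b \<le> 1"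
  shows "homotopic_paths (triangle_set a b) (short_path a b)
    (short_path a ((a + b) / 2) +++ (triangle_loop a b +++ short_path ((a + b) / 2) b))"
proof -
  let ?m = "(a + b) / 2"
  let ?S = "triangle_set a b" and ?p = "short_path a ?m" and ?q = "short_path a b" and ?r = "short_path ?m b"
  note m = midpoint_facts[OF assms]
  note f = short_path_facts[OF assms] short_path_facts[OF assms(1) m(1,2)] short_path_facts[OF m(3,4) assms(3)]
  have S: "path_image ?p \<subseteq> ?S" "path_image ?q \<subseteq> ?S" "path_image ?r \<subseteq> ?S"
    by (auto simp: triangle_set_def)
  have "homotopic_paths ?S (?p +++ (triangle_loop a b +++ ?r))
      (?p +++ (reversepath ?p +++ ((?q +++ reversepath ?r) +++ ?r)))"
    unfolding triangle_loop_def using f S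
    by (intro homotopic_paths_join homotopic_paths_sym[OF homotopic_paths_assoc]) (simp_all add: subset_path_image_join)
  also have "homotopic_paths ?S \<dots> ((?q +++ reversepath ?r) +++ ?r)"
    using f S by (intro join_cancel_left) (simp_all add: subset_path_image_join)
  also have "homotopic_paths ?S \<dots> ?q"
    using join_cancel_right[of ?q ?S "reversepath ?r"] f S by simp
  finally show ?thesis by (rule homotopic_paths_sym)
qed

section \<open>The limit path and the homotopy onto it\<close>

definition transfinite_path :: "real \<Rightarrow> 'a" where
  "transfinite_path = refine_limit \<gamma> triangle_loop short_path"

text \<open>The point v may come from a subinterval, because the limit path can sit in a loop of a
  much smaller interval while the Cantor value is only located in [a,b].\<close>

lemma triangle_set_near:
  assumes "\<epsilon> > 0"
  shows "\<exists>\<delta>>0. \<forall>a b a' b' v x. 0 \<le> a \<and> a \<le> a' \<and> a' < b' \<and> b' \<le> b \<and> b \<le> 1 \<and> b - a < \<delta> \<and>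
     v \<in> triangle_set a' b' \<and> x \<in> {a..b} \<longrightarrow> d v (\<gamma> x) < \<epsilon>"
proof -
  obtain \<delta> where \<delta>: "\<delta> > 0" "\<And>a b. 0 \<le> a \<Longrightarrow> a < b \<Longrightarrow> b \<le> 1 \<Longrightarrow> b - a < \<delta> \<Longrightarrow>
    path_image (short_path a b) \<subseteq> metric.mball (\<gamma> a) (\<epsilon> / 2)"
    using short_path_small[of "\<epsilon> / 2"] assms by auto
  \<comment> \<open>A modulus of continuity for \<gamma> comes for free, since the ball around
    \<gamma> x contains the endpoint of \<open>short_path x y\<close>.\<close>
  have lip': "d (\<gamma> x) (\<gamma> y) < \<epsilon> / 2" if "0 \<le> x" "x < y" "y \<le> 1" "y - x < \<delta>" for x y
    using \<delta>(2)[OF that] pathfinish_in_path_image[of "short_path x y"] short_path_facts[OF that(1-3)] by auto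
  have lip: "d (\<gamma> x) (\<gamma> y) < \<epsilon> / 2" if "x \<in> {0..1}" "y \<in> {0..1}" "\<bar>y - x\<bar> < \<delta>" for x y
  proof -
    consider "x < y" | "x = y" | "y < x" by linarith
    then show ?thesis
      using lip'[of x y] lip'[of y x] that \<gamma>_in assms by cases (auto simp: metric.commute)
  qed
  have "d v (\<gamma> x) < \<epsilon>" if h: "0 \<le> a" "a \<le> a'" "a' < b'" "b' \<le> b" "b \<le> 1" "b - a < \<delta>"
     "v \<in> triangle_set a' b'" "x \<in> {a..b}" for a b a' b' v x
  proof -
    have m: "a' < (a' + b') / 2" "(a' + b') / 2 < b'" using h by auto
    have "\<exists>y\<in>{a..b}. v \<in> metric.mball (\<gamma> y) (\<epsilon> / 2)"
      using h(7) unfolding triangle_set_def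
    proof (elim UnE)
      assume "v \<in> path_image (short_path a' b')"
      then show ?thesis using \<delta>(2)[of a' b'] h by (intro bexI[of _ a']) auto
    next
      assume "v \<in> path_image (short_path a' ((a' + b') / 2))"
      then show ?thesis using \<delta>(2)[of a' "(a' + b') / 2"] h m by (intro bexI[of _ a']) auto
    next
      assume "v \<in> path_image (short_path ((a' + b') / 2) b')"
      then show ?thesis using \<delta>(2)[of "(a' + b') / 2" b'] h m by (intro bexI[of _ "(a' + b') / 2"]) auto
    qed
    then obtain y where y: "y \<in> {a..b}" "v \<in> X" "d (\<gamma> y) v < \<epsilon> / 2" by auto
    have xy: "x \<in> {0..1}" "y \<in> {0..1}" using h y by auto
    have "\<bar>x - y\<bar> < \<delta>" using h y by auto
    then have "d (\<gamma> y) (\<gamma> x) < \<epsilon> / 2" using lip xy by blast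
    moreover have "d v (\<gamma> x) \<le> d v (\<gamma> y) + d (\<gamma> y) (\<gamma> x)"
      using y xy \<gamma>_in by (intro metric.triangle) auto
    ultimately show ?thesis using y(3) by (simp add: metric.commute)
  qed
  then show ?thesis using \<delta>(1) by blast
qed

lemma transfinite_path_homotopic: "homotopic_paths X (short_path 0 1) transfinite_path"
proof -
  let ?I = "{0..1::real} \<times> {0..1::real}"
  define good where "good a b h \<longleftrightarrow> continuous_on ?I h \<and> h ` ?I \<subseteq> triangle_set a b \<and>
    (\<forall>x\<in>{0..1}. h (0, x) = short_path a b x) \<and>
    (\<forall>x\<in>{0..1}. h (1, x) = (short_path a ((a + b) / 2) +++ (triangle_loop a b +++ short_path ((a + b) / 2) b)) x) \<and>
    (\<forall>u\<in>{0..1}. h (u, 0) = \<gamma> a \<and> h (u, 1) = \<gamma> b)" for a b :: real and h :: "real \<times> real \<Rightarrow> 'a"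
  have ex: "\<exists>h. good a b h" if ab: "0 \<le> a" "a < b" "b \<le> 1" for a b
  proof -
    obtain h where h: "continuous_on ?I h" "h \<in> ?I \<rightarrow> triangle_set a b"
      "\<forall>x \<in> {0..1}. h (0, x) = short_path a b x"
      "\<forall>x \<in> {0..1}. h (1, x) = (short_path a ((a + b) / 2) +++ (triangle_loop a b +++ short_path ((a + b) / 2) b)) x"
      "\<forall>t \<in> {0..1}. pathstart (h \<circ> Pair t) = pathstart (short_path a b) \<and> pathfinish (h \<circ> Pair t) = pathfinish (short_path a b)"
      using short_path_homotopic_refinement[OF ab] unfolding homotopic_paths by blast
    have "\<forall>u\<in>{0..1}. h (u, 0) = \<gamma> a \<and> h (u, 1) = \<gamma> b"
      using h(5) unfolding short_path_facts[OF ab] by (simp add: pathstart_def pathfinish_def)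
    moreover have "h ` ?I \<subseteq> triangle_set a b" using h(2) by blast
    ultimately have "good a b h" unfolding good_def using h(1,3,4) by blast
    then show ?thesis by blast
  qed
  define k where "k a b u t = (SOME h. good a b h) (u, t)" for a b u t
  have k: "continuous_on ?I (\<lambda>z. k a b (fst z) (snd z))"
    "\<And>u t. u \<in> {0..1} \<Longrightarrow> t \<in> {0..1} \<Longrightarrow> k a b u t \<in> triangle_set a b"
    "\<And>t. t \<in> {0..1} \<Longrightarrow> k a b 0 t = short_path a b t"
    "\<And>t. t \<in> {0..1} \<Longrightarrow> k a b 1 t = (short_path a ((a + b) / 2) +++ (triangle_loop a b +++ short_path ((a + b) / 2) b)) t"
    "\<And>u. u \<in> {0..1} \<Longrightarrow> k a b u 0 = \<gamma> a" "\<And>u. u \<in> {0..1} \<Longrightarrow> k a b u 1 = \<gamma> b"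
    if ab: "0 \<le> a" "a < b" "b \<le> 1" for a b
  proof -
    have g: "good a b (SOME h. good a b h)" by (rule someI_ex[OF ex[OF ab]])
    then show "continuous_on ?I (\<lambda>z. k a b (fst z) (snd z))" by (simp add: good_def k_def)
    show "k a b u t \<in> triangle_set a b" if "u \<in> {0..1}" "t \<in> {0..1}" for u t
    proof -
      have "(u, t) \<in> ?I" using that by simp
      with g show ?thesis unfolding good_def k_def by blast
    qed
    show "\<And>t. t \<in> {0..1} \<Longrightarrow> k a b 0 t = short_path a b t"
      "\<And>t. t \<in> {0..1} \<Longrightarrow> k a b 1 t = (short_path a ((a + b) / 2) +++ (triangle_loop a b +++ short_path ((a + b) / 2) b)) t"
      "\<And>u. u \<in> {0..1} \<Longrightarrow> k a b u 0 = \<gamma> a" "\<And>u. u \<in> {0..1} \<Longrightarrow> k a b u 1 = \<gamma> b"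
      using g by (simp_all add: good_def k_def)
  qed
  have compat_k: "compat \<gamma> triangle_loop (\<lambda>a b. k a b u)" if "u \<in> {0..1}" for u
    unfolding compat_def using that by (simp add: triangle_loop_facts k(5,6) pathstart_def[of "k _ _ _"] pathfinish_def[of "k _ _ _"])
  \<comment> \<open>After n subdivisions the elementary homotopies of all 2^n leaf intervals run
    simultaneously at time u; this leads from stage n to stage Suc n.\<close>
  define h where "h n u t = refine triangle_loop (\<lambda>a b. k a b u) n 0 1 t" for n u t
  have h_0: "h n 0 t = refine triangle_loop short_path n 0 1 t" if "t \<in> {0..1}" for n t
    unfolding h_def by (rule refine_cong) (use that in \<open>simp_all add: k(3)\<close>)
  have h_1: "h n 1 t = refine triangle_loop short_path (Suc n) 0 1 t" if "t \<in> {0..1}" for n t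
    unfolding h_def refine_Suc_shift by (rule refine_cong) (use that in \<open>simp_all add: k(4)\<close>)
  have k_tri: "k a b u t \<in> triangle_set a b \<and> triangle_loop a b t \<in> triangle_set a b"
    if "u \<in> {0..1}" "0 \<le> a" "a < b" "b \<le> 1" "t \<in> {0..1}" for a b u t
    using that path_image_triangle_loop[OF that(2-4)] by (auto simp: k(2) path_image_def)
  have short_path_tri: "short_path a b t \<in> triangle_set a b \<and> triangle_loop a b t \<in> triangle_set a b"
    if "0 \<le> a" "a < b" "b \<le> 1" "t \<in> {0..1}" for a b t
    using imageI[OF that(4), of "short_path a b"] imageI[OF that(4), of "triangle_loop a b"]
      path_image_triangle_loop[OF that(1-3)]
    unfolding triangle_set_def path_image_def by blast
  have lim: "\<exists>N. \<forall>n\<ge>N. \<forall>u\<in>{0..1}. \<forall>t\<in>{0..1}. transfinite_path t \<in> X \<and> d (h n u t) (transfinite_path t) < \<epsilon>"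
    if eps: "\<epsilon> > 0" for \<epsilon>
  proof -
    obtain \<delta> where \<delta>: "\<delta> > 0" "\<And>a b a' b' v x. 0 \<le> a \<Longrightarrow> a \<le> a' \<Longrightarrow> a' < b' \<Longrightarrow> b' \<le> b \<Longrightarrow> b \<le> 1 \<Longrightarrow>
       b - a < \<delta> \<Longrightarrow> v \<in> triangle_set a' b' \<Longrightarrow> x \<in> {a..b} \<Longrightarrow> d v (\<gamma> x) < \<epsilon> / 2"
      using triangle_set_near[of "\<epsilon> / 2"] eps by (metis half_gt_zero)
    obtain N where N: "(1/2) ^ N < \<delta>" using real_arch_pow_inv[OF \<delta>(1), of "1/2"] by auto
    have "transfinite_path t \<in> X \<and> d (h n u t) (transfinite_path t) < \<epsilon>"
      if n: "n \<ge> N" and u: "u \<in> {0..1}" and t: "t \<in> {0..1}" for n u t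
    proof (cases "alive n t")
      \<comment> \<open>The parameter t already lies in a loop, which the later homotopies leave
        fixed.\<close>
      case False
      have "h n u t = refine triangle_loop short_path n 0 1 t"
        unfolding h_def by (rule refine_not_alive[OF compat_k[OF u] compat_short_path _ _ _ t False]) simp_all
      moreover have "transfinite_path t = refine triangle_loop short_path n 0 1 t"
        unfolding transfinite_path_def by (rule refine_limit_not_alive[OF compat_short_path t False])
      moreover have "refine triangle_loop short_path n 0 1 t \<in> X"
      proof -
        obtain a b where "0 \<le> a" "a < b" "b \<le> 1" "refine triangle_loop short_path n 0 1 t \<in> triangle_set a b"
          using refine_range[of short_path triangle_set triangle_loop 0 1 t n, OF short_path_tri] t by auto
        then show ?thesis using triangle_set_subset by blast
      qed
      ultimately show ?thesis using eps by simp
    next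
      \<comment> \<open>Both points are compared with \<gamma> at the Cantor value of t.\<close>
      case True
      obtain a' b' t' where ab: "0 \<le> a'" "a' < b'" "b' \<le> 1" "b' - a' = (1 - 0) / 2 ^ n" "t' \<in> {0..1}"
         "0 + (1 - 0) * cantor_fun t \<in> {a'..b'}"
         "\<forall>m. refine triangle_loop (\<lambda>a b. k a b u) (n + m) 0 1 t = refine triangle_loop (\<lambda>a b. k a b u) m a' b' t'"
         "\<forall>m. refine triangle_loop short_path (n + m) 0 1 t = refine triangle_loop short_path m a' b' t'"
        using refine_alive[OF compat_k[OF u] compat_short_path _ _ _ t True, of 0 1] by auto
      have "(1/2::real) ^ n \<le> (1/2) ^ N" using n by (intro power_decreasing) auto
      then have small: "b' - a' < \<delta>" using N ab(4) by (simp add: power_divide)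
      have c: "cantor_fun t \<in> {a'..b'}" using ab(6) by simp
      have c01: "cantor_fun t \<in> {0..1}" using cantor_fun_range[OF t] .
      have "h n u t = k a' b' u t'" using ab(7)[rule_format, of 0] by (simp add: h_def)
      then have hs: "h n u t \<in> triangle_set a' b'" using k(2)[OF ab(1-3) u ab(5)] by simp
      then have hX: "h n u t \<in> X" using triangle_set_subset[OF ab(1-3)] by blast
      have h1: "d (h n u t) (\<gamma> (cantor_fun t)) < \<epsilon> / 2"
        by (rule \<delta>(2)[OF ab(1) order_refl ab(2) order_refl ab(3) small hs c])
      have f1: "transfinite_path t \<in> X \<and> d (transfinite_path t) (\<gamma> (cantor_fun t)) < \<epsilon> / 2"
      proof (cases "t \<in> cantor_set")
        case True
        then have "transfinite_path t = \<gamma> (cantor_fun t)"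
          unfolding transfinite_path_def by (rule refine_limit_cantor_set)
        then show ?thesis using \<gamma>_in[OF c01] eps by simp
      next
        case False
        then obtain l where l: "\<not> alive l t" using t by (auto simp: cantor_set_def)
        \<comment> \<open>Such a t enters a loop only after stage n, so the value lies in the
          triangle set of a subinterval of [a',b'].\<close>
        then have "n \<le> l" using alive_antimono[OF True, of l] by linarith
        then have "transfinite_path t = refine triangle_loop short_path (n + (l - n)) 0 1 t"
          unfolding transfinite_path_def using refine_limit_not_alive[OF compat_short_path t l] by simp
        also have "\<dots> = refine triangle_loop short_path (l - n) a' b' t'" using ab(8) by blast
        finally have eq: "transfinite_path t = refine triangle_loop short_path (l - n) a' b' t'" .
        obtain a b where s: "a' \<le> a" "a < b" "b \<le> b'" "transfinite_path t \<in> triangle_set a b"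
          unfolding eq using refine_range[of short_path triangle_set triangle_loop a' b' t' "l - n", OF short_path_tri ab(1-3,5)] by blast
        have "transfinite_path t \<in> X" using triangle_set_subset[of a b] s ab by auto
        moreover have "d (transfinite_path t) (\<gamma> (cantor_fun t)) < \<epsilon> / 2"
          by (rule \<delta>(2)[OF ab(1) s(1-3) ab(3) small s(4) c])
        ultimately show ?thesis by blast
      qed
      have "d (h n u t) (transfinite_path t) \<le> d (h n u t) (\<gamma> (cantor_fun t)) + d (\<gamma> (cantor_fun t)) (transfinite_path t)"
        using hX f1 \<gamma>_in[OF c01] by (intro metric.triangle) auto
      then show ?thesis using h1 f1 by (simp add: metric.commute)
    qed
    then show ?thesis by blast
  qed
  have "homotopic_paths X (h 0 0) transfinite_path"
  proof (rule homotopic_paths_infinite_concatenation[OF metric mtop])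
    show "continuous_on ({0..1} \<times> {0..1}) (\<lambda>z. h n (fst z) (snd z))" for n
      unfolding h_def
      by (rule continuous_on_refine[OF compat_k k(1) triangle_loop_facts(1)]) simp_all
    show "h n u t \<in> X" if u: "u \<in> {0..1}" and t: "t \<in> {0..1}" for n u t
    proof -
      have "\<exists>a b. 0 \<le> a \<and> a < b \<and> b \<le> 1 \<and> h n u t \<in> triangle_set a b"
        unfolding h_def by (rule refine_range[OF k_tri[OF u]]) (use t in simp_all)
      then show ?thesis using triangle_set_subset by blast
    qed
    show "h n 1 t = h (Suc n) 0 t" if "t \<in> {0..1}" for n t
      using h_0[OF that] h_1[OF that] by simp
    have e: "transfinite_path 0 = \<gamma> 0" "transfinite_path 1 = \<gamma> 1"
      unfolding transfinite_path_def
      by (simp_all add: refine_limit_cantor_set cantor_set_0 cantor_set_1)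
    show "h n u 0 = transfinite_path 0" "h n u 1 = transfinite_path 1" if "u \<in> {0..1}" for n u
      using refine_ends[OF compat_k[OF that], of 0 1 n] unfolding e h_def
      by (simp_all add: pathstart_def pathfinish_def)
    show "transfinite_path t \<in> X" if "t \<in> {0..1}" for t
      using lim[of 1] that by (auto dest: spec)
    show "\<exists>N. \<forall>n\<ge>N. \<forall>u\<in>{0..1}. \<forall>t\<in>{0..1}. d (h n u t) (transfinite_path t) < \<epsilon>" if "\<epsilon> > 0" for \<epsilon>
      using lim[OF that] by meson
  qed
  moreover have "homotopic_paths X (short_path 0 1) (h 0 0)"
    using short_path_facts[of 0 1] by (intro homotopic_paths_eq) (simp_all add: h_0)
  ultimately show ?thesis by (rule homotopic_paths_trans[rotated])
qed

text \<open>At the ends of a gap the limit path is \<gamma> at the Cantor value, that is at (a + b)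
  / 2, which is where the loop starts and finishes. So the description of the open gap extends to
  its closure.\<close>

lemma transfinite_path_gap:
  assumes "t \<in> {0..1}" "t \<notin> cantor_set"
  shows "\<exists>p q a b. 0 \<le> p \<and> p < t \<and> t < q \<and> q \<le> 1 \<and> p \<in> cantor_set \<and> q \<in> cantor_set \<and>
    {p<..<q} \<inter> cantor_set = {} \<and> 0 \<le> a \<and> a < b \<and> b \<le> 1 \<and>
    (\<forall>x\<in>{0..1}. transfinite_path (p + (q - p) * x) = triangle_loop a b x \<and>
       cantor_fun (p + (q - p) * x) = (a + b) / 2)"
proof -
  obtain n where n: "\<not> alive n t" using assms by (auto simp: cantor_set_def)
  obtain p q a b where pq: "0 \<le> p" "p < t" "t < q" "q \<le> 1" "p \<in> cantor_set" "q \<in> cantor_set"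
     "0 \<le> a" "a < b" "b \<le> 1"
     "\<forall>x. 0 < x \<and> x < 1 \<longrightarrow> \<not> alive n (p + (q - p) * x) \<and>
        refine triangle_loop short_path n 0 1 (p + (q - p) * x) = triangle_loop a b x"
     "\<forall>x\<in>{0..1}. 0 + (1 - 0) * cantor_fun (p + (q - p) * x) = (a + b) / 2"
    using refine_gap[OF compat_short_path _ _ _ assms(1) n, of 0 1] by auto
  have c: "cantor_fun (p + (q - p) * x) = (a + b) / 2" if "x \<in> {0..1}" for x
    using pq(11) that by simp
  have r: "p + (q - p) * x \<in> {0..1}" if "x \<in> {0..1}" for x
  proof -
    have "p \<in> {0..1}" "q \<in> {0..1}" using pq(1-4) by auto
    from affine_image_subset_unit[OF this] show ?thesis using that by blast
  qed
  have "transfinite_path (p + (q - p) * x) = triangle_loop a b x" if x: "x \<in> {0..1}" for x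
  proof -
    consider "x = 0" | "x = 1" | "0 < x" "x < 1" using x by force
    then show ?thesis
    proof cases
      case 1
      then have "p + (q - p) * x \<in> cantor_set" using pq(5) by simp
      then have "transfinite_path (p + (q - p) * x) = \<gamma> ((a + b) / 2)"
        using refine_limit_cantor_set c[OF x] unfolding transfinite_path_def by metis
      then show ?thesis using triangle_loop_facts(3)[OF pq(7-9)] 1 by (simp add: pathstart_def)
    next
      case 2
      then have "p + (q - p) * x \<in> cantor_set" using pq(6) by simp
      then have "transfinite_path (p + (q - p) * x) = \<gamma> ((a + b) / 2)"
        using refine_limit_cantor_set c[OF x] unfolding transfinite_path_def by metis
      then show ?thesis using triangle_loop_facts(4)[OF pq(7-9)] 2 by (simp add: pathfinish_def)
    next
      case 3
      then have "\<not> alive n (p + (q - p) * x)" "refine triangle_loop short_path n 0 1 (p + (q - p) * x) = triangle_loop a b x"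
        using pq(10) by auto
      then show ?thesis
        unfolding transfinite_path_def using refine_limit_not_alive[OF compat_short_path r[OF x]] by simp
    qed
  qed
  moreover have "z \<notin> cantor_set" if z: "z \<in> {p<..<q}" for z
  proof -
    have "p + (q - p) * ((z - p) / (q - p)) = z" using z by simp
    moreover have "\<not> alive n (p + (q - p) * ((z - p) / (q - p)))"
      using pq(10)[rule_format, of "(z - p) / (q - p)"] z by (simp add: divide_simps)
    ultimately have "\<not> alive n z" by simp
    then show ?thesis unfolding cantor_set_def by blast
  qed
  then have "{p<..<q} \<inter> cantor_set = {}" by blast
  ultimately show ?thesis using pq(1-9) c by blast
qed

end

subsection \<open>Transfinite products imply unique path lifting\<close>

lemma joinpaths_second_half:
  assumes "pathfinish p = q 0" "y \<in> {0..1}"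
  shows "(p +++ q) ((y + 1) / 2) = q y"
  using assms by (cases "y = 0") (auto simp: joinpaths_def pathfinish_def field_simps)

lemma unit_component_bounds:
  fixes a b :: real
  assumes "{a<..<b} = {p<..<q}" "p < q"
  shows "a = p \<and> b = q"
proof -
  have "a < b" using assms by (metis greaterThanLessThan_empty_iff not_le)
  then show ?thesis
    using assms cInf_greaterThanLessThan cSup_greaterThanLessThan by metis
qed

context class_lift
begin

lemma path_transfinite_path: "path transfinite_path" "path_image transfinite_path \<subseteq> X"
  using homotopic_paths_imp_path[OF transfinite_path_homotopic]
    homotopic_paths_imp_subset[OF transfinite_path_homotopic] by auto

lemma transfinite_path_0: "transfinite_path 0 = \<gamma> 0"
  by (simp add: transfinite_path_def refine_limit_cantor_set cantor_set_0)

lemma base_path: "\<phi> 0 \<in> P" "pathfinish (\<phi> 0) = \<gamma> 0" "\<phi> 1 \<in> P"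
  using \<phi> \<gamma> by auto

lemma cantor_path: "path (\<gamma> \<circ> cantor_fun)" "path_image (\<gamma> \<circ> cantor_fun) \<subseteq> X"
  "homotopic_paths X (\<gamma> \<circ> cantor_fun) \<gamma>"
proof -
  have im: "cantor_fun ` {0..1} \<subseteq> {0..1}" using cantor_fun_range by blast
  show "path (\<gamma> \<circ> cantor_fun)" "path_image (\<gamma> \<circ> cantor_fun) \<subseteq> X"
    using path_in_via_real[OF path_\<gamma> cantor_fun_continuous im] by auto
  show "homotopic_paths X (\<gamma> \<circ> cantor_fun) \<gamma>"
    using homotopic_paths_compose_real[OF path_\<gamma> cantor_fun_continuous continuous_on_id im]
    by (simp add: comp_def)
qed

text \<open>Prepending \<phi> 0 makes both paths start at x0. The closed set A consists of the first
  half of the parameter interval, where they share \<phi> 0, and a copy of the Cantor set in the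
  second half. On each gap one path runs through a triangle loop while the other stands
  still.\<close>

lemma hrel_transfinite_path: "hrel (\<phi> 0 +++ transfinite_path) (\<phi> 0 +++ (\<gamma> \<circ> cantor_fun))"
proof -
  let ?\<alpha> = "\<phi> 0 +++ transfinite_path" and ?\<beta> = "\<phi> 0 +++ (\<gamma> \<circ> cantor_fun)"
  let ?c = "\<lambda>y::real. (y + 1) / 2"
  define A where "A = {0..1/2} \<union> ?c ` cantor_set"
  have cs: "cantor_set \<subseteq> {0..1}" by (auto simp: cantor_set_def)
  have "compact cantor_set"
    using closed_cantor_set cs compact_Int_closed[of "{0..1}" cantor_set] by (simp add: Int_absorb1)
  then have "compact (?c ` cantor_set)"
    by (rule compact_continuous_image[rotated]) (auto intro!: continuous_intros)
  then have clA: "closed A" unfolding A_def by (intro closed_Un compact_imp_closed) auto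
  have A01: "A \<subseteq> {0..1}" using cs by (auto simp: A_def)
  have A0: "0 \<in> A" "1 \<in> A" using cantor_set_1 by (auto simp: A_def image_iff intro!: bexI[of _ 1])
  \<comment> \<open>For y = 0 this is the junction 1/2, which belongs to both parts of A.\<close>
  have A_iff: "?c y \<in> A \<longleftrightarrow> y \<in> cantor_set" if "0 \<le> y" for y
    using that cantor_set_0 by (auto simp: A_def)
  have PP: "?\<alpha> \<in> P" "?\<beta> \<in> P"
    using base_path path_transfinite_path cantor_path(1,2) transfinite_path_0
    by (simp_all add: P_join pathstart_def)
  have val: "?\<alpha> (?c y) = transfinite_path y" "?\<beta> (?c y) = \<gamma> (cantor_fun y)" if "y \<in> {0..1}" for y
    using joinpaths_second_half[of "\<phi> 0" transfinite_path y]
      joinpaths_second_half[of "\<phi> 0" "\<gamma> \<circ> cantor_fun" y] base_path transfinite_path_0 that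
    by auto
  have agree: "\<forall>t\<in>A. ?\<alpha> t = ?\<beta> t"
  proof
    fix t assume "t \<in> A"
    then consider "t \<in> {0..1/2}" | y where "y \<in> cantor_set" "t = ?c y" by (auto simp: A_def)
    then show "?\<alpha> t = ?\<beta> t"
    proof cases
      case 1
      then show ?thesis by (simp add: joinpaths_def)
    next
      case 2
      then have "y \<in> {0..1}" using cs by blast
      then show ?thesis
        unfolding 2(2) using val[of y] 2(1)
        by (simp add: transfinite_path_def refine_limit_cantor_set)
    qed
  qed
  have gap: "path_class X (restrict_path 0 b ?\<alpha> +++ reversepath (restrict_path a b ?\<beta>)
               +++ reversepath (restrict_path 0 a ?\<alpha>)) \<in> H"
    if comp: "{a<..<b} \<in> components ({0..1} - A)" for a b
  proof -
    obtain t where t: "t \<in> {a<..<b}" using in_components_nonempty[OF comp] by blast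
    then have tA: "t \<in> {0..1}" "t \<notin> A" using in_components_subset[OF comp] by auto
    define y where "y = 2 * t - 1"
    have ty: "t = ?c y" by (simp add: y_def)
    have "1/2 < t" using tA by (auto simp: A_def)
    then have y: "y \<in> {0..1}" using tA by (auto simp: y_def)
    have "y \<notin> cantor_set" using tA(2) A_iff[of y] y unfolding ty by auto
    then obtain p q u v where pq: "0 \<le> p" "p < y" "y < q" "q \<le> 1" "p \<in> cantor_set" "q \<in> cantor_set"
      "{p<..<q} \<inter> cantor_set = {}" "0 \<le> u" "u < v" "v \<le> 1"
      "\<forall>x\<in>{0..1}. transfinite_path (p + (q - p) * x) = triangle_loop u v x \<and>
         cantor_fun (p + (q - p) * x) = (u + v) / 2"
      using transfinite_path_gap[OF y] by blast
    have lt: "?c p < ?c q" using pq by simp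
    have disj: "{?c p<..<?c q} \<inter> A = {}"
    proof -
      have False if z: "z \<in> {?c p<..<?c q}" "z \<in> A" for z
      proof -
        have e: "z = ?c (2 * z - 1)" by simp
        have i: "2 * z - 1 \<in> {p<..<q}" using z(1) by auto
        then have "?c (2 * z - 1) \<in> A \<longleftrightarrow> 2 * z - 1 \<in> cantor_set" using pq(1) by (intro A_iff) auto
        then show False using z(2) i pq(7) e by auto
      qed
      then show ?thesis by blast
    qed
    have "{?c p<..<?c q} \<in> components ({0..1} - A)"
      using pq(1,5,6) A_iff[of p] A_iff[of q] pq(2,3) y lt disj by (intro gap_in_components[OF A01]) auto
    moreover have "t \<in> {?c p<..<?c q}" using pq(2,3) unfolding ty by auto
    \<comment> \<open>Components that share t coincide, so the given a and b are the ends of the gap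
      just found.\<close>
    ultimately have "{a<..<b} = {?c p<..<?c q}" using components_eq[OF comp] t by blast
    then have ab: "a = ?c p" "b = ?c q" using unit_component_bounds lt by blast+
    have I: "a \<in> {0..1}" "b \<in> {0..1}" "(0::real) \<in> {0..1}" using pq unfolding ab by auto
    have line: "a + (b - a) * x = ?c (p + (q - p) * x)" for x unfolding ab by (simp add: field_simps)
    have r: "p + (q - p) * x \<in> {0..1}" if "x \<in> {0..1}" for x
    proof -
      have "p \<in> {0..1}" "q \<in> {0..1}" using pq(1-4) by auto
      from affine_image_subset_unit[OF this] show ?thesis using that by blast
    qed
    let ?m = "(u + v) / 2"
    have \<alpha>: "restrict_path a b ?\<alpha> x = triangle_loop u v x" if "x \<in> {0..1}" for x
      unfolding restrict_path_def line using val(1)[OF r[OF that]] pq(11) that by simp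
    have \<beta>: "restrict_path a b ?\<beta> x = \<gamma> ?m" if "x \<in> {0..1}" for x
      unfolding restrict_path_def line using val(2)[OF r[OF that]] pq(11) that by metis
    have \<alpha>\<beta>: "path ?\<alpha>" "path_image ?\<alpha> \<subseteq> X" "path ?\<beta>" "path_image ?\<beta> \<subseteq> X" using PP by (auto simp: P_iff)
    define \<psi> where "\<psi> = restrict_path 0 a ?\<alpha>"
    have \<psi>: "\<psi> \<in> P" "pathfinish \<psi> = ?\<alpha> a" unfolding \<psi>_def using P_restrict[OF PP(1) I(1)] by auto
    have a1: "?\<alpha> a = \<gamma> ?m"
      using \<alpha>[of 0] triangle_loop_facts(3)[OF pq(8-10)] by (simp add: restrict_path_def pathstart_def)
    have b1: "?\<beta> a = \<gamma> ?m" using \<beta>[of 0] by (simp add: restrict_path_def)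
    note mid = midpoint_facts[OF pq(8-10)]
    have m: "?m \<in> {0..1}" using mid by simp
    have "hrel (restrict_path 0 b ?\<alpha>) (\<psi> +++ restrict_path a b ?\<alpha>)"
    proof (rule hrel_sym[OF hrel_homotopic])
      show "homotopic_paths X (\<psi> +++ restrict_path a b ?\<alpha>) (restrict_path 0 b ?\<alpha>)"
        unfolding \<psi>_def by (rule restrict_path_join_homotopic[OF \<alpha>\<beta>(1,2) I(3,1,2)])
      show "\<psi> +++ restrict_path a b ?\<alpha> \<in> P"
        using P_join[OF \<psi>(1) path_restrict_path[OF I(1,2) \<alpha>\<beta>(1)]
            path_image_restrict_path_subset[OF I(1,2) \<alpha>\<beta>(2)]] \<psi>(2) by simp
    qed
    also have "hrel \<dots> (\<psi> +++ triangle_loop u v)"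
      using \<psi> I \<alpha>\<beta> \<alpha>
      by (intro hrel_join_homotopic homotopic_paths_eq path_restrict_path path_image_restrict_path_subset) simp_all
    \<comment> \<open>The loop is known to act trivially on the class of \<open>\<phi> ?m\<close>,
      while \<psi> is the approach along the limit path; normality bridges the two.\<close>
    also have "hrel \<dots> \<psi>"
    proof (rule hrel_normal_loop[OF normal _ \<phi>[OF m] \<psi>(1)])
      show "hrel (\<phi> ?m +++ triangle_loop u v) (\<phi> ?m)"
        using triangle_loop_lift[OF pq(8-10)] by (simp only: lift_path_def)
      show "pathfinish \<psi> = pathfinish (\<phi> ?m)" unfolding \<psi>(2) a1 \<gamma>[OF m] by (rule refl)
      show "pathstart (triangle_loop u v) = pathfinish (\<phi> ?m)"
        unfolding \<gamma>[OF m] by (rule triangle_loop_facts(3)[OF pq(8-10)])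
    qed (rule triangle_loop_facts[OF pq(8-10)])+
    also have "hrel \<psi> (\<psi> +++ restrict_path a b ?\<beta>)"
    proof -
      have "hrel (\<psi> +++ restrict_path a b ?\<beta>) (\<psi> +++ (\<lambda>_. \<gamma> ?m))"
        using \<psi> I \<alpha>\<beta> \<beta> a1 b1
        by (intro hrel_join_homotopic homotopic_paths_eq path_restrict_path path_image_restrict_path_subset) simp_all
      also have "hrel \<dots> \<psi>"
        using \<psi> a1 \<gamma>_in[OF m] by (intro hrel_homotopic right_const_homotopic P_join) (simp_all add: P_iff)
      finally show ?thesis by (rule hrel_sym)
    qed
    finally have "hrel (restrict_path 0 b ?\<alpha>) (\<psi> +++ restrict_path a b ?\<beta>)" .
    moreover have "reversepath (\<psi> +++ restrict_path a b ?\<beta>)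
        = reversepath (restrict_path a b ?\<beta>) +++ reversepath \<psi>"
      using \<psi> a1 b1 by (intro reversepath_joinpaths) simp_all
    ultimately show ?thesis unfolding hrel_iff quot_def \<psi>_def by simp
  qed
  have "path_class X (?\<alpha> +++ reversepath ?\<beta>) \<in> H"
    using products clA A01 A0 PP agree gap
    unfolding well_defined_transfinite_products_def by blast
  moreover have "pathfinish ?\<alpha> = pathfinish ?\<beta>"
    using agree A0(2) by (simp add: pathfinish_def)
  ultimately show ?thesis using PP by (simp add: hrel_iff quot_def)
qed

lemma hrel_lift_endpoint: "hrel (\<phi> 1) (\<phi> 0 +++ \<gamma>)"
proof -
  have s: "pathstart (short_path 0 1) = \<gamma> 0" "lift_path \<phi> 0 1 (short_path 0 1)" using short_path_facts(3)[of 0 1] short_path(2)[of 0 1] by auto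
  have "hrel (\<phi> 1) (\<phi> 0 +++ short_path 0 1)" using s(2) by (simp add: lift_path_def hrel_sym)
  also have "hrel \<dots> (\<phi> 0 +++ transfinite_path)"
    using base_path s by (intro hrel_join_homotopic transfinite_path_homotopic) simp_all
  also have "hrel \<dots> (\<phi> 0 +++ (\<gamma> \<circ> cantor_fun))" by (rule hrel_transfinite_path)
  also have "hrel \<dots> (\<phi> 0 +++ \<gamma>)"
    using base_path by (intro hrel_join_homotopic cantor_path(3)) (simp_all add: pathstart_def)
  finally show ?thesis .
qed

end

section \<open>From arbitrary lifts to unique lifting\<close>

context path_subgroup
begin

text \<open>Continuity of \<open>f\<close> at t means that nearby classes arise from the class at t
  by appending paths inside U, which is the local hypothesis of \<open>class_lift\<close>. The
  resulting formula expresses f 1 through the initial class and the projected path alone.\<close>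

lemma path_cover_lift_endpoint:
  assumes metriz: "metrizable_space (top_of_set X)" and normal: "H \<lhd> G"
    and products: "well_defined_transfinite_products X x0 H"
    and f: "pathin (path_cover X x0 H) f" and \<psi>: "\<psi> \<in> P" "f 0 = cls \<psi>"
  shows "path (endpoint_proj \<circ> f)" "path_image (endpoint_proj \<circ> f) \<subseteq> X"
    "pathstart (endpoint_proj \<circ> f) = pathfinish \<psi>" "f 1 = cls (\<psi> +++ (endpoint_proj \<circ> f))"
proof -
  obtain M d where M: "Metric_space M d" "top_of_set X = Metric_space.mtopology M d"
    using metriz unfolding metrizable_space_def by blast
  have "M = X"
    using Metric_space.topspace_mtopology[OF M(1)] unfolding M(2)[symmetric] by simp
  then have d: "Metric_space X d" "Metric_space.mtopology X d = top_of_set X"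
    using M by simp_all
  have "\<exists>\<phi>. \<phi> \<in> P \<and> f t = cls \<phi>" if "t \<in> {0..1}" for t
  proof -
    have "f t \<in> topspace (path_cover X x0 H)" using path_image_subset_topspace[OF f] that by blast
    then show ?thesis unfolding topspace_path_cover H_class_def by (auto elim: quotientE)
  qed
  then obtain \<phi>0 where \<phi>0: "\<And>t. t \<in> {0..1} \<Longrightarrow> \<phi>0 t \<in> P \<and> f t = cls (\<phi>0 t)" by metis
  \<comment> \<open>The prescribed \<psi> is kept as representative at 0, so two lifts with the same
    start receive formulas with the same initial path.\<close>
  define \<phi> where "\<phi> t = (if t = 0 then \<psi> else \<phi>0 t)" for t
  have reps: "\<phi> t \<in> P" "f t = cls (\<phi> t)" if "t \<in> {0..1}" for t
    using \<phi>0[OF that] \<psi> by (auto simp: \<phi>_def)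
  let ?\<gamma> = "endpoint_proj \<circ> f"
  have ends: "pathfinish (\<phi> t) = ?\<gamma> t" if "t \<in> {0..1}" for t
    using reps[OF that] endpoint_proj_H_class[OF base_in subgroup_H] by simp
  have local_lift: "\<exists>\<delta>>0. \<forall>s\<in>{0..1}. dist s t < \<delta> \<longrightarrow> (\<exists>e. lift_path \<phi> t s e \<and> path_image e \<subseteq> U)"
    if t: "t \<in> {0..1}" and U: "openin (top_of_set X) U" "?\<gamma> t \<in> U" for t U
  proof -
    let ?B = "basic_nbhd X x0 H (\<phi> t) U"
    have "f t \<in> ?B" using cls_in_basic_nbhd[of "\<phi> t" U] reps[OF t] ends[OF t] U by simp
    moreover have "openin (top_of_set {0..1}) {s \<in> {0..1}. f s \<in> ?B}"
    proof -
      have "openin (path_cover X x0 H) ?B"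
        unfolding path_cover_def using reps(1)[OF t] ends[OF t] U by (intro topology_generated_by_Basis CollectI exI[of _ "\<phi> t"] exI[of _ U]) auto
      from openin_continuous_map_preimage[OF f[unfolded pathin_def] this] show ?thesis by simp
    qed
    ultimately have "\<exists>\<delta>>0. \<forall>s\<in>{0..1}. dist s t < \<delta> \<longrightarrow> s \<in> {s \<in> {0..1}. f s \<in> ?B}"
      using t unfolding openin_euclidean_subtopology_iff by blast
    then obtain \<delta> where \<delta>: "\<delta> > 0" "\<And>s. s\<in>{0..1} \<Longrightarrow> dist s t < \<delta> \<Longrightarrow> f s \<in> ?B"
      by blast
    have "\<exists>e. lift_path \<phi> t s e \<and> path_image e \<subseteq> U" if s: "s \<in> {0..1}" "dist s t < \<delta>" for s
    proof -
      obtain e where e: "cls (\<phi> s) = cls (\<phi> t +++ e)" "path e" "path_image e \<subseteq> X"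
        "pathstart e = pathfinish (\<phi> t)" "path_image e \<subseteq> U"
        using \<delta>(2)[OF s] unfolding reps(2)[OF s(1)] basic_nbhd_def paths_from_def by blast
      have "\<phi> t +++ e \<in> P" using e reps(1)[OF t] by (intro P_join)
      then have h: "hrel (\<phi> s) (\<phi> t +++ e)"
        using e(1) cls_eq_iff[OF reps(1)[OF s(1)]] by simp
      then have "pathfinish e = pathfinish (\<phi> s)" by (simp add: hrel_iff)
      then have "lift_path \<phi> t s e" using e hrel_sym[OF h] unfolding lift_path_def by simp
      then show ?thesis using e(5) by blast
    qed
    then show ?thesis using \<delta>(1) by blast
  qed
  interpret class_lift X x0 H \<phi> ?\<gamma> d
  proof (rule class_lift.intro[OF path_subgroup_axioms], rule class_lift_axioms.intro)
    show "Metric_space X d" "Metric_space.mtopology X d = top_of_set X" "H \<lhd> G"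
      "well_defined_transfinite_products X x0 H"
      by (rule d normal products)+
  qed (rule reps(1) ends local_lift; assumption)+
  show "path ?\<gamma>" "path_image ?\<gamma> \<subseteq> X" by (rule path_\<gamma>)+
  show "pathstart ?\<gamma> = pathfinish \<psi>" using ends[of 0] by (simp add: \<phi>_def pathstart_def)
  have "hrel (\<phi> 1) (\<psi> +++ ?\<gamma>)" using hrel_lift_endpoint by (simp add: \<phi>_def)
  then have "cls (\<phi> 1) = cls (\<psi> +++ ?\<gamma>)" by (subst cls_eq_iff) (auto simp: hrel_iff)
  then show "f 1 = cls (\<psi> +++ ?\<gamma>)" using reps(2)[of 1] by simp
qed

lemma unique_path_lifting_if_transfinite_products:
  assumes "metrizable_space (top_of_set X)" "H \<lhd> G" "well_defined_transfinite_products X x0 H"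
  shows "unique_path_lifting (path_cover X x0 H) endpoint_proj"
  unfolding unique_path_lifting_def
proof (intro allI impI ballI, elim conjE)
  fix f g and t :: real
  assume fg: "pathin (path_cover X x0 H) f" "pathin (path_cover X x0 H) g" "f 0 = g 0"
    "\<forall>t\<in>{0..1}. endpoint_proj (f t) = endpoint_proj (g t)" and t: "t \<in> {0..1}"
  \<comment> \<open>Slowing time down by the factor t turns the value at t into an endpoint, where
    the formula applies.\<close>
  define f' g' where "f' = f \<circ> (\<lambda>s. t * s)" and "g' = g \<circ> (\<lambda>s. t * s)"
  have ts: "t * s \<in> {0..1}" if "s \<in> {0..1}" for s
    using t that by (auto intro: mult_le_one)
  have "continuous_map (top_of_set {0..1}) (top_of_set {0..1}) (\<lambda>s. t * s)"
    using ts by (auto intro!: continuous_intros)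
  from continuous_map_compose[OF this] have c: "pathin (path_cover X x0 H) f'" "pathin (path_cover X x0 H) g'"
    using fg(1,2) unfolding pathin_def f'_def g'_def by blast+
  have "f 0 \<in> topspace (path_cover X x0 H)" using fg(1) by (rule path_start_in_topspace)
  then obtain \<psi> where \<psi>: "\<psi> \<in> P" "f 0 = cls \<psi>"
    unfolding topspace_path_cover H_class_def by (auto elim: quotientE)
  have 0: "f' 0 = cls \<psi>" "g' 0 = cls \<psi>" using \<psi> fg(3) by (simp_all add: f'_def g'_def)
  note F = path_cover_lift_endpoint[OF assms c(1) \<psi>(1) 0(1)]
    and G' = path_cover_lift_endpoint[OF assms c(2) \<psi>(1) 0(2)]
  have "homotopic_paths X (endpoint_proj \<circ> f') (endpoint_proj \<circ> g')"
  proof (rule homotopic_paths_eq[OF F(1,2)])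
    show "(endpoint_proj \<circ> f') s = (endpoint_proj \<circ> g') s" if "s \<in> {0..1}" for s
      using fg(4) ts[OF that] by (simp add: f'_def g'_def)
  qed
  then have "homotopic_paths X (\<psi> +++ (endpoint_proj \<circ> f')) (\<psi> +++ (endpoint_proj \<circ> g'))"
    using F \<psi> by (intro homotopic_paths_join) (auto simp: P_iff)
  then have "f' 1 = g' 1" using F(4) G'(4) H_class_cong by metis
  then show "f t = g t" by (simp add: f'_def g'_def)
qed

end

theorem theorem6p10:
  fixes X :: "'a::topological_space set"
    and x0 :: 'a
    and H :: "(real \<Rightarrow> 'a) set set"
  assumes "path_connected X"
    and "x0 \<in> X"
    and "subgroup H (fundamental_group X x0)"
  shows "(unique_path_lifting (path_cover X x0 H) endpoint_proj
            \<longrightarrow> well_defined_transfinite_products X x0 H) \<and>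
         (metrizable_space (top_of_set X) \<and> H \<lhd> fundamental_group X x0
            \<longrightarrow> well_defined_transfinite_products X x0 H
            \<longrightarrow> unique_path_lifting (path_cover X x0 H) endpoint_proj)"
proof -
  interpret path_subgroup X x0 H by (rule path_subgroup.intro[OF assms(2,3)])
  show ?thesis
    using transfinite_products_if_unique_path_lifting unique_path_lifting_if_transfinite_products
    by blast
qed

end
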